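(* Let $\mathfrak{X}=(X,\{R_r\}_{r=0}^d)$ be a $Q$-polynomial association scheme with respect to the ordering $E_0,\dots,E_d$ of its primitive idempotents, with base vertex $u_0$ and Terwilliger algebra $T=T(u_0)$. Let $e,r_1,\dots,r_p$ be integers with $p-1\le e\le d$ and $0\le r_1<r_2<\cdots<r_p\le d$. Suppose every irreducible $T$-module $W$ with dual endpoint $\rho^*(W)\le e$ is dual thin, satisfies $\rho^*(W)+\delta(W)\ge e$, and satisfies $|\{i\in\{1,\dots,p\} : E_{r_i}^*W\ne 0\}|\ge\min\{p,\ e-\rho^*(W)+1\}$. Then, with $S=X_{r_1}\cup\cdots\cup X_{r_p}$, \[ \dim\big(L_0(S)+L_1(S)+\cdots+L_e(S)\big)=m_e+m_{e-1}+\cdots+m_{e-p+1}. \]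
   Context: $\mathfrak{X}$ is a symmetric $d$-class association scheme on the finite set $X$ with adjacency matrices $A_0,\dots,A_d$ and primitive idempotents $E_0,\dots,E_d$, the latter in a $Q$-polynomial ordering. Shells: $X_r=\{x: (u_0,x)\in R_r\}$. $L_j(X)$ is the column space of $E_j$ (viewed as a space of functions on $X$), $m_j=\mathrm{rank}\,E_j$, and for $S\subseteq X$, $L_j(S)=\{f|_S : f\in L_j(X)\}$. Terwilliger algebra: $E_i^*$ is the diagonal matrix with $(E_i^* )_{xx}=(A_i)_{u_0x}$; $T$ is the algebra generated by $A_0,\dots,A_d,E_0^*,\dots,E_d^*$ acting on $\mathbb{C}^X$. For an irreducible $T$-module $W$: dual endpoint $\rho^*(W)=\min\{i : E_iW\ne 0\}$; diameter $\delta(W)=|\{i: E_i^*W\ne 0\}|-1$; $W$ is dual thin if $\dim E_iW\le 1$ for all $i$. *)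

theory Defs
  imports "HOL-Analysis.Analysis"
begin

text \<open>The vertex set X is the (finite) universe of the type 'a.  Functions on X are
  vectors in complex^'a, matrices indexed by X are complex^'a^'a.  The scheme is given by
  a relation-index function rel, where (x,y) in R_i iff rel x y = i.\<close>

definition sym_assoc_scheme :: "nat \<Rightarrow> ('a::finite \<Rightarrow> 'a \<Rightarrow> nat) \<Rightarrow> bool" where
  "sym_assoc_scheme d rel \<longleftrightarrow>
     (\<forall>x y. rel x y \<le> d) \<and>
     (\<forall>x y. rel x y = 0 \<longleftrightarrow> x = y) \<and>
     (\<forall>x y. rel x y = rel y x) \<and>
     (\<forall>i\<le>d. \<exists>x y. rel x y = i) \<and>
     (\<forall>h\<le>d. \<forall>i\<le>d. \<forall>j\<le>d. \<forall>x y z w. rel x y = h \<longrightarrow> rel z w = h \<longrightarrow>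
        card {u. rel x u = i \<and> rel u y = j} = card {u. rel z u = i \<and> rel u w = j})"

definition adj :: "('a::finite \<Rightarrow> 'a \<Rightarrow> nat) \<Rightarrow> nat \<Rightarrow> complex^'a^'a" where
  "adj rel i = (\<chi> x y. if rel x y = i then 1 else 0)"

definition dual_idem :: "('a::finite \<Rightarrow> 'a \<Rightarrow> nat) \<Rightarrow> 'a \<Rightarrow> nat \<Rightarrow> complex^'a^'a" where
  "dual_idem rel u0 i = (\<chi> x y. if x = y \<and> rel u0 x = i then 1 else 0)"

definition shell :: "('a::finite \<Rightarrow> 'a \<Rightarrow> nat) \<Rightarrow> 'a \<Rightarrow> nat \<Rightarrow> 'a set" where
  "shell rel u0 r = {x. rel u0 x = r}"

text \<open>E 0, ..., E d are the primitive idempotents of the Bose-Mesner algebra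
  (nonzero, pairwise orthogonal idempotents summing to I, lying in span of A_0..A_d;
  as the Bose-Mesner algebra has dimension d+1 these are exactly the primitive idempotents),
  with E 0 = J/|X|.\<close>
definition primitive_idempotents ::
  "nat \<Rightarrow> ('a::finite \<Rightarrow> 'a \<Rightarrow> nat) \<Rightarrow> (nat \<Rightarrow> complex^'a^'a) \<Rightarrow> bool" where
  "primitive_idempotents d rel E \<longleftrightarrow>
     (\<forall>i\<le>d. \<forall>j\<le>d. E i ** E j = (if i = j then E i else 0)) \<and>
     (\<forall>i\<le>d. E i \<noteq> 0) \<and>
     (\<Sum>i\<le>d. E i) = mat 1 \<and>
     (\<forall>i\<le>d. \<exists>c::nat \<Rightarrow> complex. \<forall>x y. E i $ x $ y = (\<Sum>k\<le>d. c k * adj rel k $ x $ y)) \<and>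
     E 0 = (\<chi> x y. 1 / of_nat CARD('a))"

text \<open>Q-polynomial ordering: the Krein parameters q^h_{1j}, defined by
  E_1 \<circ> E_j = |X|^{-1} sum_h q^h_{1j} E_h, vanish for |h-j|>1 and are nonzero for |h-j|=1.\<close>
definition Q_polynomial :: "nat \<Rightarrow> (nat \<Rightarrow> complex^'a::finite^'a) \<Rightarrow> bool" where
  "Q_polynomial d E \<longleftrightarrow> (1 \<le> d \<longrightarrow>
     (\<exists>q::nat \<Rightarrow> nat \<Rightarrow> complex.
        (\<forall>j\<le>d. \<forall>x y. E 1 $ x $ y * E j $ x $ y =
              (\<Sum>h\<le>d. q h j * E h $ x $ y) / of_nat CARD('a)) \<and>
        (\<forall>h\<le>d. \<forall>j\<le>d. (h > j + 1 \<or> j > h + 1 \<longrightarrow> q h j = 0) \<and>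
                         (h = j + 1 \<or> j = h + 1 \<longrightarrow> q h j \<noteq> 0))))"

inductive_set terwilliger :: "nat \<Rightarrow> ('a::finite \<Rightarrow> 'a \<Rightarrow> nat) \<Rightarrow> 'a \<Rightarrow> (complex^'a^'a) set"
  for d rel u0 where
  gen_A: "i \<le> d \<Longrightarrow> adj rel i \<in> terwilliger d rel u0"
| gen_Es: "i \<le> d \<Longrightarrow> dual_idem rel u0 i \<in> terwilliger d rel u0"
| one: "mat 1 \<in> terwilliger d rel u0"
| add: "M \<in> terwilliger d rel u0 \<Longrightarrow> N \<in> terwilliger d rel u0 \<Longrightarrow> M + N \<in> terwilliger d rel u0"
| smult: "M \<in> terwilliger d rel u0 \<Longrightarrow> (\<chi> x y. c * M $ x $ y) \<in> terwilliger d rel u0"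
| mult: "M \<in> terwilliger d rel u0 \<Longrightarrow> N \<in> terwilliger d rel u0 \<Longrightarrow> M ** N \<in> terwilliger d rel u0"

definition T_invariant :: "(complex^'a::finite^'a) set \<Rightarrow> (complex^'a) set \<Rightarrow> bool" where
  "T_invariant T W \<longleftrightarrow> (\<forall>M\<in>T. \<forall>w\<in>W. M *v w \<in> W)"

definition irreducible_module :: "(complex^'a::finite^'a) set \<Rightarrow> (complex^'a) set \<Rightarrow> bool" where
  "irreducible_module T W \<longleftrightarrow>
     vec.subspace W \<and> W \<noteq> {0} \<and> T_invariant T W \<and>
     (\<forall>U. vec.subspace U \<and> U \<subseteq> W \<and> T_invariant T U \<longrightarrow> U = {0} \<or> U = W)"

definition dual_endpoint :: "(nat \<Rightarrow> complex^'a::finite^'a) \<Rightarrow> (complex^'a) set \<Rightarrow> nat" where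
  "dual_endpoint E W = (LEAST i. \<exists>w\<in>W. E i *v w \<noteq> 0)"

definition module_diameter ::
  "nat \<Rightarrow> (nat \<Rightarrow> complex^'a::finite^'a) \<Rightarrow> (complex^'a) set \<Rightarrow> nat" where
  "module_diameter d Es W = card {i. i \<le> d \<and> (\<exists>w\<in>W. Es i *v w \<noteq> 0)} - 1"

definition dual_thin :: "nat \<Rightarrow> (nat \<Rightarrow> complex^'a::finite^'a) \<Rightarrow> (complex^'a) set \<Rightarrow> bool" where
  "dual_thin d E W \<longleftrightarrow> (\<forall>i\<le>d. vec.dim ((\<lambda>w. E i *v w) ` W) \<le> 1)"

text \<open>L_j(X) = column space of E_j.  A function f on X restricted to S is represented by
  its extension by zero outside S (an isomorphic copy of the space of functions on S).\<close>
definition Lspace :: "complex^'a::finite^'a \<Rightarrow> (complex^'a) set" where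
  "Lspace Ej = range (\<lambda>v. Ej *v v)"

definition restrict_vec :: "'a::finite set \<Rightarrow> complex^'a \<Rightarrow> complex^'a" where
  "restrict_vec S f = (\<chi> x. if x \<in> S then f $ x else 0)"

definition Lspace_on :: "complex^'a::finite^'a \<Rightarrow> 'a set \<Rightarrow> (complex^'a) set" where
  "Lspace_on Ej S = restrict_vec S ` Lspace Ej"

end

theory Submission
  imports Defs "HOL-Computational_Algebra.Polynomial"
begin

text \<open>
  Let \<open>D\<close> be the dual adjacency matrix, the diagonal matrix built from the row of
  \<open>E\<^sub>1\<close> at the base vertex. Its eigenvalues on the shells are distinct, and
  \<open>E\<^sub>i D E\<^sub>j = 0\<close> for \<open>i > j + 1\<close>, because the sum of the squared
  norms of these matrices over all base vertices is a multiple of a vanishing Krein parameter.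
  For an irreducible dual thin module \<open>W\<close> with dual endpoint \<open>\<rho>\<close>, take
  \<open>w \<noteq> 0\<close> in \<open>E\<^sub>\<rho> W\<close>. The vectors \<open>D\<^sup>k w\<close> with
  \<open>k \<le> n\<close> lie in \<open>E\<^sub>\<rho> W + \<dots> + E\<^bsub>\<rho>+n\<^esub> W\<close>, a space
  of dimension at most \<open>n + 1\<close>, while polynomial interpolation gives the dimension of
  their span, namely the smaller of \<open>n + 1\<close> and the number of shells met by the support
  of \<open>w\<close>. Comparing dimensions shows that the two spaces agree as long as
  \<open>\<rho> + n \<le> e\<close>. Restriction to \<open>S\<close> commutes with \<open>D\<close>, so the same
  interpolation argument computes the contribution of \<open>W\<close> to both sides of the claim,
  and orthogonal complements split the whole space into irreducible modules.
\<close>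

section \<open>Linear algebra\<close>

lemma sum_matrix_vector_mult:
  "(\<Sum>i\<in>I. A i) *v x = (\<Sum>i\<in>I. A i *v x)" for A :: "'i \<Rightarrow> 'b::field^'n^'m"
  by (induction I rule: infinite_finite_induct) (auto simp: matrix_vector_mult_add_rdistrib)

lemma matrix_vector_mult_axis: "(A *v axis k 1) $ x = A $ x $ k" for A :: "'b::field^'n^'m"
proof -
  have "(A *v axis k 1) $ x = (\<Sum>y\<in>UNIV. if y = k then A $ x $ k else 0)"
    unfolding matrix_vector_mult_def axis_def vec_lambda_beta by (rule sum.cong) auto
  then show ?thesis by simp
qed

lemma matrix_vector_mult_linear_combination:
  fixes A :: "'i \<Rightarrow> 'b::field^'n^'m"
  assumes "\<And>x y. M $ x $ y = (\<Sum>j\<in>I. c j * A j $ x $ y)"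
  shows "M *v v = (\<Sum>j\<in>I. c j *s (A j *v v))"
proof -
  have "(M *v v) $ x = (\<Sum>j\<in>I. c j *s (A j *v v)) $ x" for x
  proof -
    have "(M *v v) $ x = (\<Sum>y\<in>UNIV. \<Sum>j\<in>I. c j * (A j $ x $ y * v $ y))"
      by (simp add: matrix_vector_mult_def assms sum_distrib_right mult.assoc)
    also have "\<dots> = (\<Sum>j\<in>I. \<Sum>y\<in>UNIV. c j * (A j $ x $ y * v $ y))"
      by (rule sum.swap)
    also have "\<dots> = (\<Sum>j\<in>I. c j *s (A j *v v)) $ x"
      by (simp add: matrix_vector_mult_def sum_distrib_left)
    finally show ?thesis .
  qed
  then show ?thesis by (simp add: vec_eq_iff)
qed

text \<open>The hypothesis ranges over coefficients indexed by \<open>I\<close>, so it also forces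
  \<open>v\<close> to be injective on \<open>I\<close>; the image then consists of
  \<open>card I\<close> independent vectors.\<close>

lemma dim_independent_family:
  fixes v :: "'i \<Rightarrow> 'b::field^'n"
  assumes fin: "finite I"
    and indep: "\<And>c. (\<Sum>i\<in>I. c i *s v i) = 0 \<Longrightarrow> \<forall>i\<in>I. c i = 0"
  shows "vec.dim (v ` I) = card I"
proof -
  have inj: "inj_on v I"
  proof (rule inj_onI, rule ccontr)
    fix i j assume ij: "i \<in> I" "j \<in> I" "v i = v j" "i \<noteq> j"
    \<comment> \<open>If \<open>v i = v j\<close>, coefficients 1 at \<open>i\<close> and -1 at
      \<open>j\<close> give a nontrivial vanishing combination.\<close>
    let ?c = "\<lambda>k. (if k = i then 1 else 0) - (if k = j then 1 else 0) :: 'b"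
    have "(\<Sum>k\<in>I. ?c k *s v k)
        = (\<Sum>k\<in>I. if k = i then v k else 0) - (\<Sum>k\<in>I. if k = j then v k else 0)"
      by (simp add: vec.scale_left_diff_distrib sum_subtractf if_distrib[where f = "\<lambda>a. a *s _"]
          cong: if_cong)
    also have "\<dots> = 0"
      using ij fin by simp
    finally have "?c i = 0"
      using indep[of ?c] ij by blast
    with ij show False by simp
  qed
  have "vec.independent (v ` I)"
  proof (rule vec.independent_if_scalars_zero)
    fix f u assume "(\<Sum>x\<in>v ` I. f x *s x) = 0" "u \<in> v ` I"
    then show "f u = 0"
      using indep[of "f \<circ> v"] by (auto simp: sum.reindex[OF inj])
  qed (use fin in simp)
  then show ?thesis
    by (simp add: vec.dim_eq_card_independent card_image inj)
qed

text \<open>Coefficients are attached to indices rather than to vectors, which takes care of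
  repeated values of \<open>v\<close>; the induction peels off one generator at a time.\<close>

lemma span_image_finite_sum:
  fixes v :: "'i \<Rightarrow> 'b::field^'n"
  assumes "finite I" "x \<in> vec.span (v ` I)"
  shows "\<exists>c. x = (\<Sum>i\<in>I. c i *s v i)"
  using assms
proof (induction I arbitrary: x rule: finite_induct)
  case (insert i I)
  then obtain k where "x - k *s v i \<in> vec.span (v ` I)"
    by (auto simp: vec.span_insert)
  with insert obtain c where c: "x - k *s v i = (\<Sum>j\<in>I. c j *s v j)"
    by blast
  have "x = (\<Sum>j\<in>insert i I. (c(i := k)) j *s v j)"
  proof -
    have "(\<Sum>j\<in>I. (c(i := k)) j *s v j) = (\<Sum>j\<in>I. c j *s v j)"
      using insert by (intro sum.cong) auto
    with insert c show ?thesis by (simp add: algebra_simps)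
  qed
  then show ?case by blast
qed simp

lemma dim_sums_le:
  fixes S T :: "('b::field^'n) set"
  assumes "vec.subspace S" "vec.subspace T"
  shows "vec.dim {x + y |x y. x \<in> S \<and> y \<in> T} \<le> vec.dim S + vec.dim T"
  using vec.dim_sums_Int[OF assms] by linarith

section \<open>Krylov spaces of a diagonal matrix\<close>

definition weighted_power :: "('a \<Rightarrow> 'b) \<Rightarrow> nat \<Rightarrow> 'b^'a::finite \<Rightarrow> 'b::field^'a" where
  "weighted_power \<tau> k w = (\<chi> x. \<tau> x ^ k * w $ x)"

text \<open>With \<open>D\<close> the diagonal matrix of entries \<open>\<tau> x\<close>, the vector
  \<open>weighted_power \<tau> k w\<close> is \<open>D^k w\<close>. The index \<open>n\<close>
  counts generators, so the exponents stop at \<open>n - 1\<close>.\<close>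

definition krylov :: "('a \<Rightarrow> 'b) \<Rightarrow> 'b^'a::finite \<Rightarrow> nat \<Rightarrow> ('b::field^'a) set" where
  "krylov \<tau> w n = vec.span ((\<lambda>k. weighted_power \<tau> k w) ` {..<n})"

lemma weighted_power_Suc:
  "weighted_power \<tau> (Suc k) w = weighted_power \<tau> 1 (weighted_power \<tau> k w)"
  by (simp add: weighted_power_def vec_eq_iff)

text \<open>The coefficients of a vanishing combination form a polynomial of degree below
  \<open>n\<close> that has a root at every value of \<open>\<tau>\<close> on the support of
  \<open>w\<close>. There are at least \<open>n\<close> such values, so the polynomial is
  zero.\<close>

lemma dim_krylov_full:
  assumes "n \<le> card (\<tau> ` {x. w $ x \<noteq> 0})"
  shows "vec.dim (krylov \<tau> w n) = n"
proof -
  have "vec.dim ((\<lambda>k. weighted_power \<tau> k w) ` {..<n}) = card {..<n}"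
  proof (rule dim_independent_family)
    fix c assume c: "(\<Sum>i\<in>{..<n}. c i *s weighted_power \<tau> i w) = 0"
    define f where "f = (\<Sum>i<n. monom (c i) i)"
    have root: "poly f t = 0" if t: "t \<in> \<tau> ` {x. w $ x \<noteq> 0}" for t
    proof -
      obtain x where x: "w $ x \<noteq> 0" "t = \<tau> x" using t by blast
      have "(\<Sum>i<n. c i * (\<tau> x ^ i * w $ x)) = 0"
        using arg_cong[OF c, of "\<lambda>v. v $ x"] by (simp add: weighted_power_def)
      then have "(\<Sum>i<n. c i * \<tau> x ^ i) * w $ x = 0"
        by (simp add: sum_distrib_right mult.assoc)
      with x show ?thesis by (simp add: f_def poly_sum poly_monom)
    qed
    have deg: "degree f < n" if "n \<noteq> 0"
      unfolding f_def using that
      by (intro degree_sum_less) (auto intro: le_less_trans[OF degree_monom_le])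
    have "f = 0"
    proof (cases "n = 0")
      case False
      then show ?thesis
        using root deg assms
        by (intro poly_eqI_degree[of "\<tau> ` {x. w $ x \<noteq> 0}"]) auto
    qed (simp add: f_def)
    moreover have "coeff f i = c i" if "i < n" for i
      using that by (simp add: f_def coeff_sum)
    ultimately show "\<forall>i\<in>{..<n}. c i = 0" by fastforce
  qed simp
  then show ?thesis by (simp add: krylov_def)
qed

lemma krylov_mono: "m \<le> n \<Longrightarrow> krylov \<tau> w m \<subseteq> krylov \<tau> w n"
  unfolding krylov_def by (intro vec.span_mono image_mono) auto

lemma dim_krylov:
  "vec.dim (krylov \<tau> w n) = min n (card (\<tau> ` {x. w $ x \<noteq> 0}))"
proof (cases "n \<le> card (\<tau> ` {x. w $ x \<noteq> 0})")
  case True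
  then show ?thesis using dim_krylov_full by (simp add: min_def)
next
  case False
  let ?s = "card (\<tau> ` {x. w $ x \<noteq> 0})"
  \<comment> \<open>\<open>?b t\<close> is the component of \<open>w\<close> in the eigenspace of
    \<open>D\<close> for \<open>t\<close>, so \<open>D^k w\<close> is the sum of the
    \<open>t^k ?b t\<close> and one generator per eigenvalue suffices.\<close>
  let ?b = "\<lambda>t. \<chi> x. if \<tau> x = t then w $ x else 0"
  have "weighted_power \<tau> k w \<in> vec.span (?b ` \<tau> ` {x. w $ x \<noteq> 0})" for k
  proof -
    have "weighted_power \<tau> k w = (\<Sum>t\<in>\<tau> ` {x. w $ x \<noteq> 0}. t ^ k *s ?b t)"
      by (auto simp: weighted_power_def vec_eq_iff if_distrib[where f = "\<lambda>a. _ * a"] cong: if_cong)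
    also have "\<dots> \<in> vec.span (?b ` \<tau> ` {x. w $ x \<noteq> 0})"
      by (intro vec.span_sum vec.span_scale vec.span_base) blast
    finally show ?thesis .
  qed
  then have "krylov \<tau> w n \<subseteq> vec.span (?b ` \<tau> ` {x. w $ x \<noteq> 0})"
    unfolding krylov_def by (intro vec.span_minimal vec.subspace_span) auto
  then have "vec.dim (krylov \<tau> w n) \<le> card (?b ` \<tau> ` {x. w $ x \<noteq> 0})"
    by (intro vec.dim_le_card) auto
  also have "\<dots> \<le> ?s" by (rule card_image_le) simp
  finally have "vec.dim (krylov \<tau> w n) \<le> ?s" .
  moreover have "?s \<le> vec.dim (krylov \<tau> w n)"
    using vec.dim_subset[OF krylov_mono[of ?s n \<tau> w]] False dim_krylov_full[of ?s \<tau> w] by simp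
  ultimately show ?thesis using False by simp
qed

section \<open>The Bose--Mesner algebra\<close>

lemma adj_nth: "adj rel k $ x $ y = (if rel x y = k then 1 else 0)"
  by (simp add: adj_def)

lemma dual_idem_vec_nth: "(dual_idem rel u0 i *v w) $ x = (if rel u0 x = i then w $ x else 0)"
proof -
  have "(dual_idem rel u0 i *v w) $ x
      = (\<Sum>y\<in>UNIV. if y = x then (if rel u0 x = i then w $ x else 0) else 0)"
    unfolding dual_idem_def matrix_vector_mult_def vec_lambda_beta by (rule sum.cong) auto
  then show ?thesis by simp
qed

text \<open>Spectral decomposition of \<open>D^k\<close> for a \<open>D\<close> that is constant on
  shells; it shows that submodules are stable under \<open>D\<close>.\<close>

lemma weighted_power_dual_idem:
  assumes "\<And>x. rel u0 x \<le> d"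
  shows "weighted_power (\<lambda>x. \<theta> (rel u0 x)) k w = (\<Sum>i\<le>d. \<theta> i ^ k *s (dual_idem rel u0 i *v w))"
  using assms by (simp add: weighted_power_def vec_eq_iff dual_idem_vec_nth
      if_distrib[where f = "\<lambda>a. _ * a"] cong: if_cong)

locale Q_polynomial_scheme =
  fixes d :: nat and rel :: "'a::finite \<Rightarrow> 'a \<Rightarrow> nat" and E :: "nat \<Rightarrow> complex^'a^'a"
  assumes scheme: "sym_assoc_scheme d rel"
    and idem: "primitive_idempotents d rel E"
    and Qpoly: "Q_polynomial d E"
begin

lemmas scheme_conjs = scheme[unfolded sym_assoc_scheme_def]

lemmas rel_le = scheme_conjs[THEN conjunct1, rule_format]
  and rel_eq_0 = scheme_conjs[THEN conjunct2, THEN conjunct1, rule_format]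
  and rel_commute = scheme_conjs[THEN conjunct2, THEN conjunct2, THEN conjunct1, rule_format]
  and relation_nonempty =
    scheme_conjs[THEN conjunct2, THEN conjunct2, THEN conjunct2, THEN conjunct1, rule_format]
  and intersection_number =
    scheme_conjs[THEN conjunct2, THEN conjunct2, THEN conjunct2, THEN conjunct2, rule_format]

text \<open>The count of \<open>u\<close> with \<open>rel x u = k = rel u x\<close> is an
  intersection number for the diagonal relation, hence the same at every vertex, and it is nonzero
  at an endpoint of some pair in relation \<open>k\<close>.\<close>

lemma relation_at:
  assumes "k \<le> d"
  shows "\<exists>y. rel x y = k"
proof -
  obtain z w where zw: "rel z w = k"
    using relation_nonempty[OF assms] by blast
  have "card {u. rel x u = k \<and> rel u x = k} = card {u. rel z u = k \<and> rel u z = k}"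
    using assms by (intro intersection_number[of 0]) (simp_all add: rel_eq_0)
  moreover have "w \<in> {u. rel z u = k \<and> rel u z = k}"
    using zw rel_commute by auto
  then have "card {u. rel z u = k \<and> rel u z = k} \<noteq> 0"
    by auto
  ultimately have "card {u. rel x u = k \<and> rel u x = k} \<noteq> 0"
    by (simp only: not_False_eq_True)
  then have "{u. rel x u = k \<and> rel u x = k} \<noteq> {}"
    by (metis card.empty)
  then show ?thesis by blast
qed

lemma E_mult: "i \<le> d \<Longrightarrow> j \<le> d \<Longrightarrow> E i ** E j = (if i = j then E i else 0)"
  and E_nonzero: "i \<le> d \<Longrightarrow> E i \<noteq> 0"
  and E_sum: "(\<Sum>i\<le>d. E i) = mat 1"
  using idem unfolding primitive_idempotents_def by blast+

lemma E_mult_vec: "i \<le> d \<Longrightarrow> j \<le> d \<Longrightarrow> E i *v (E j *v v) = (if i = j then E i *v v else 0)"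
  by (simp add: matrix_vector_mul_assoc E_mult)

lemma E_sum_vec: "(\<Sum>i\<le>d. E i *v v) = v"
  by (simp add: sum_matrix_vector_mult[symmetric] E_sum)

lemma E_0: "E 0 $ x $ y = 1 / of_nat CARD('a)"
  using idem unfolding primitive_idempotents_def by simp

text \<open>Up to the factor \<open>|X|\<close>, these are the entries of the second eigenmatrix.\<close>

definition Q :: "nat \<Rightarrow> nat \<Rightarrow> complex" where
  "Q = (SOME Q. \<forall>i\<le>d. \<forall>x y. E i $ x $ y = Q i (rel x y))"

text \<open>Each \<open>E i\<close> is a combination of adjacency matrices, whose entries depend
  only on the relation; the coefficients serve as \<open>Q i\<close>.\<close>

lemma E_nth:
  assumes "i \<le> d"
  shows "E i $ x $ y = Q i (rel x y)"
proof -
  have "\<forall>i\<in>{..d}. \<exists>q. \<forall>x y. E i $ x $ y = q (rel x y)"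
  proof
    fix i assume "i \<in> {..d}"
    then have "\<exists>c. \<forall>x y. E i $ x $ y = (\<Sum>k\<le>d. c k * adj rel k $ x $ y)"
      using idem unfolding primitive_idempotents_def by (meson atMost_iff)
    then obtain c where c: "\<forall>x y. E i $ x $ y = (\<Sum>k\<le>d. c k * adj rel k $ x $ y)"
      by blast
    have "E i $ x $ y = c (rel x y)" for x y
      using c rel_le[of x y] by (simp add: adj_nth if_distrib[where f = "\<lambda>a. _ * a"] cong: if_cong)
    then show "\<exists>q. \<forall>x y. E i $ x $ y = q (rel x y)" by blast
  qed
  from bchoice[OF this] have "\<exists>Q. \<forall>i\<le>d. \<forall>x y. E i $ x $ y = Q i (rel x y)"
    by (simp add: Ball_def)
  from someI_ex[OF this] assms show ?thesis
    unfolding Q_def by blast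
qed

lemma E_nth_commute: "i \<le> d \<Longrightarrow> E i $ x $ y = E i $ y $ x"
  by (metis E_nth rel_commute)

text \<open>The rows of the \<open>E j\<close> at a fixed vertex are \<open>d + 1\<close>
  independent vectors in the span of the \<open>d + 1\<close> shell indicators, hence a basis of it.
  One row determines the whole matrix because every relation occurs at every vertex. So the
  \<open>E j\<close> span the Bose-Mesner algebra.\<close>

lemma function_of_rel_in_span:
  "\<exists>c. \<forall>x y. q (rel x y) = (\<Sum>j\<le>d. c j * E j $ x $ y)"
proof -
  fix u0 :: 'a
  let ?a = "\<lambda>k. \<chi> x. if rel u0 x = k then 1 else 0 :: complex^'a"
  let ?q = "\<chi> x. q (rel u0 x)"
  let ?e = "\<lambda>j. \<chi> x. Q j (rel u0 x)"
  have e: "?e j = E j *v axis u0 1" if "j \<le> d" for j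
    unfolding vec_eq_iff
  proof
    fix x
    show "?e j $ x = (E j *v axis u0 1) $ x"
      unfolding matrix_vector_mult_axis E_nth[OF that] by (simp add: rel_commute[of u0 x])
  qed
  have e_nonzero: "?e j \<noteq> 0" if j: "j \<le> d" for j
  proof -
    obtain x y where "E j $ x $ y \<noteq> 0"
      using E_nonzero[OF j] by (auto simp: vec_eq_iff)
    then have "Q j (rel x y) \<noteq> 0" by (simp add: E_nth j)
    moreover obtain z where "rel u0 z = rel x y"
      using relation_at[OF rel_le] by blast
    ultimately show ?thesis
      by (auto simp: vec_eq_iff intro!: exI[of _ z])
  qed
  have "vec.dim (?e ` {..d}) = card {..d}"
  proof (rule dim_independent_family)
    fix c assume c: "(\<Sum>j\<in>{..d}. c j *s ?e j) = 0"
    have "c i = 0" if i: "i \<le> d" for i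
    proof -
      \<comment> \<open>Each \<open>?e j\<close> lies in the image of \<open>E j\<close>, so
        applying \<open>E i\<close> isolates the coefficient \<open>c i\<close>.\<close>
      have "E i *v (\<Sum>j\<in>{..d}. c j *s ?e j) = (\<Sum>j\<in>{..d}. c j *s (E i *v (E j *v axis u0 1)))"
        by (simp add: vec.sum vec.scale e)
      also have "\<dots> = c i *s ?e i"
        using i by (simp add: E_mult_vec e if_distrib[where f = "\<lambda>a. _ *s a"] cong: if_cong)
      finally show ?thesis
        using c e_nonzero[OF i] by simp
    qed
    then show "\<forall>i\<in>{..d}. c i = 0" by simp
  qed simp
  moreover have sub: "vec.span (?e ` {..d}) \<subseteq> vec.span (?a ` {..d})"
  proof (intro vec.span_minimal vec.subspace_span image_subsetI)
    fix j assume "j \<in> {..d}"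
    have "?e j = (\<Sum>k\<le>d. Q j k *s ?a k)"
      by (simp add: vec_eq_iff rel_le if_distrib[where f = "\<lambda>a. _ * a"] cong: if_cong)
    also have "\<dots> \<in> vec.span (?a ` {..d})"
      by (intro vec.span_sum vec.span_scale vec.span_base) blast
    finally show "?e j \<in> vec.span (?a ` {..d})" .
  qed
  moreover have "vec.dim (?a ` {..d}) \<le> card {..d}"
    using vec.dim_le_card'[of "?a ` {..d}"] card_image_le[of "{..d}" ?a] by simp
  ultimately have "vec.span (?e ` {..d}) = vec.span (?a ` {..d})"
    by (intro vec.subspace_dim_equal) (auto simp: vec.dim_span)
  moreover have "?q \<in> vec.span (?a ` {..d})"
  proof -
    have "?q = (\<Sum>k\<le>d. q k *s ?a k)"
      by (simp add: vec_eq_iff rel_le if_distrib[where f = "\<lambda>a. _ * a"] cong: if_cong)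
    also have "\<dots> \<in> vec.span (?a ` {..d})"
      by (intro vec.span_sum vec.span_scale vec.span_base) blast
    finally show ?thesis .
  qed
  ultimately obtain c where c: "?q = (\<Sum>j\<in>{..d}. c j *s ?e j)"
    using span_image_finite_sum[of "{..d}" ?q ?e] by auto
  have "q (rel x y) = (\<Sum>j\<le>d. c j * E j $ x $ y)" for x y
  proof -
    obtain z where z: "rel u0 z = rel x y"
      using relation_at[OF rel_le] by blast
    show ?thesis
      using arg_cong[OF c, of "\<lambda>v. v $ z"] z by (simp add: E_nth)
  qed
  then show ?thesis by blast
qed

lemma adj_vec_in_span:
  "\<exists>c. \<forall>v. adj rel k *v v = (\<Sum>j\<le>d. c j *s (E j *v v))"
proof -
  obtain c where c: "\<forall>x y. (if rel x y = k then 1 else 0) = (\<Sum>j\<le>d. c j * E j $ x $ y)"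
    using function_of_rel_in_span[of "\<lambda>h. if h = k then 1 else 0"] by blast
  have "adj rel k *v v = (\<Sum>j\<le>d. c j *s (E j *v v))" for v
    by (rule matrix_vector_mult_linear_combination) (simp only: adj_nth c)
  then show ?thesis by blast
qed

text \<open>The conjugate of \<open>E\<^sub>i\<close> is a combination of the \<open>E\<^sub>j\<close> that is killed by the
  conjugate of every other \<open>E\<^sub>j\<close>; since no \<open>E\<^sub>j\<close> is killed by its own conjugate, only
  \<open>E\<^sub>i\<close> occurs.\<close>

lemma E_real:
  assumes i: "i \<le> d"
  shows "cnj (E i $ x $ y) = E i $ x $ y"
proof -
  let ?C = "\<lambda>i. \<chi> x y. cnj (E i $ x $ y)"
  have C_mult: "?C i *v (?C j *v v) = (if i = j then ?C i *v v else 0)" if "i \<le> d" "j \<le> d" for i j v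
  proof -
    have "?C i ** ?C j = (\<chi> x y. cnj ((E i ** E j) $ x $ y))"
      by (simp add: matrix_matrix_mult_def vec_eq_iff)
    then show ?thesis
      using that by (simp add: matrix_vector_mul_assoc E_mult) (simp add: vec_eq_iff matrix_vector_mult_def)
  qed
  have C_E: "\<exists>v. ?C j *v (E j *v v) \<noteq> 0" if j: "j \<le> d" for j
  proof -
    obtain x y where xy: "E j $ x $ y \<noteq> 0"
      using E_nonzero[OF j] by (auto simp: vec_eq_iff)
    \<comment> \<open>By symmetry of \<open>E j\<close> this entry is the squared norm of its row
      \<open>x\<close>, which is nonzero at \<open>y\<close>.\<close>
    have "(?C j *v (E j *v axis x 1)) $ x = (\<Sum>z\<in>UNIV. cnj (E j $ x $ z) * E j $ z $ x)"
      unfolding matrix_vector_mult_def[of _ "E j *v _"] by (simp add: matrix_vector_mult_axis)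
    also have "\<dots> = of_real (\<Sum>z\<in>UNIV. (cmod (E j $ x $ z))\<^sup>2)"
      unfolding of_real_sum
      by (intro sum.cong refl) (metis E_nth_commute j complex_norm_square mult.commute)
    also have "\<dots> \<noteq> 0"
    proof -
      have "(\<Sum>z\<in>UNIV. (cmod (E j $ x $ z))\<^sup>2) > 0"
        using xy by (intro sum_pos2[where i = y]) auto
      then show ?thesis by (metis of_real_eq_0_iff less_irrefl)
    qed
    finally have "?C j *v (E j *v axis x 1) \<noteq> 0" by (metis zero_index)
    then show ?thesis by blast
  qed
  have "\<exists>b. \<forall>x y. ?C i $ x $ y = (\<Sum>j\<le>d. b j * E j $ x $ y)"
    using function_of_rel_in_span[of "\<lambda>h. cnj (Q i h)"] i by (simp add: E_nth)
  then obtain b where b: "\<And>x y. ?C i $ x $ y = (\<Sum>j\<le>d. b j * E j $ x $ y)"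
    by blast
  have Cb: "?C i *v v = (\<Sum>j\<le>d. b j *s (E j *v v))" for v
    using b by (rule matrix_vector_mult_linear_combination)
  have b0: "b j = 0" if j: "j \<le> d" "j \<noteq> i" for j
  proof -
    obtain v where v: "?C j *v (E j *v v) \<noteq> 0" using C_E[OF j(1)] by blast
    have "?C i *v (E j *v v) = b j *s (E j *v v)"
      using j by (simp add: Cb E_mult_vec if_distrib[where f = "\<lambda>a. _ *s a"] cong: if_cong)
    then have "b j *s (?C j *v (E j *v v)) = ?C j *v (?C i *v (E j *v v))"
      by (simp add: vec.scale)
    also have "\<dots> = 0" using C_mult[of j i] i j by simp
    finally show ?thesis using v by simp
  qed
  have "(\<Sum>j\<le>d. b j * E j $ x $ y) = (\<Sum>j\<le>d. if j = i then b i * E i $ x $ y else 0)" for x y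
    using b0 by (intro sum.cong) auto
  then have CE: "?C i $ x $ y = b i * E i $ x $ y" for x y
    using b i by simp
  then have Cv: "?C i *v v = b i *s (E i *v v)" for v
    by (simp add: vec_eq_iff matrix_vector_mult_def sum_distrib_left mult.assoc)
  obtain v where v: "?C i *v (E i *v v) \<noteq> 0" using C_E[OF i] by blast
  have "b i *s (b i *s (E i *v v)) = b i *s (E i *v v)"
    using C_mult[of i i v] i by (simp add: Cv vec.scale E_mult_vec)
  moreover have "b i \<noteq> 0" "E i *v v \<noteq> 0"
    using v i by (auto simp: Cv E_mult_vec)
  ultimately have "b i = 1" by (simp add: vec.scale_right_imp_eq)
  then show ?thesis using CE[of x y] by simp
qed

end

section \<open>Dual eigenvalues\<close>

context Q_polynomial_scheme
begin

lemma Krein: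
  assumes "1 \<le> d"
  obtains q where
    "\<And>j x y. j \<le> d \<Longrightarrow> E 1 $ x $ y * E j $ x $ y = (\<Sum>h\<le>d. q h j * E h $ x $ y) / of_nat CARD('a)"
    "\<And>h j. h \<le> d \<Longrightarrow> j \<le> d \<Longrightarrow> j + 1 < h \<Longrightarrow> q h j = 0"
    "\<And>j. j + 1 \<le> d \<Longrightarrow> q (j + 1) j \<noteq> 0"
proof -
  from mp[OF Qpoly[unfolded Q_polynomial_def] assms] obtain q where q:
    "\<forall>j\<le>d. \<forall>x y. E 1 $ x $ y * E j $ x $ y = (\<Sum>h\<le>d. q h j * E h $ x $ y) / of_nat CARD('a)"
    "\<forall>h\<le>d. \<forall>j\<le>d. (h > j + 1 \<or> j > h + 1 \<longrightarrow> q h j = 0) \<and> (h = j + 1 \<or> j = h + 1 \<longrightarrow> q h j \<noteq> 0)"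
    by (elim exE conjE)
  show thesis
  proof (rule that[of q])
    show "E 1 $ x $ y * E j $ x $ y = (\<Sum>h\<le>d. q h j * E h $ x $ y) / of_nat CARD('a)"
      if "j \<le> d" for j x y
      using q(1)[rule_format, OF that] .
    show "q h j = 0" if "h \<le> d" "j \<le> d" "j + 1 < h" for h j
      using q(2)[rule_format, of h j] that by simp
    show "q (j + 1) j \<noteq> 0" if "j + 1 \<le> d" for j
      using q(2)[rule_format, of "j + 1" j] that by simp
  qed
qed

text \<open>Solving the Krein expansion of the entrywise product of \<open>E 1\<close> and
  \<open>E j\<close> for its top term gives a recurrence that expresses every entry of
  \<open>E (j + 1)\<close> through the entries of \<open>E 1\<close> and of lower idempotents. Hence
  if \<open>Q 1\<close> agrees on \<open>k\<close> and \<open>l\<close>, so do all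
  \<open>E j\<close>, and with them the indicator of relation \<open>k\<close>.\<close>

lemma inj_on_Q_1:
  assumes "1 \<le> d"
  shows "inj_on (Q 1) {..d}"
proof (rule inj_onI)
  fix k l assume kl: "k \<in> {..d}" "l \<in> {..d}" "Q 1 k = Q 1 l"
  fix u :: 'a
  obtain y z where y: "rel u y = k" and z: "rel u z = l"
    using relation_at kl by (meson atMost_iff)
  obtain q where q:
    "\<And>j x y. j \<le> d \<Longrightarrow> E 1 $ x $ y * E j $ x $ y = (\<Sum>h\<le>d. q h j * E h $ x $ y) / of_nat CARD('a)"
    "\<And>h j. h \<le> d \<Longrightarrow> j \<le> d \<Longrightarrow> j + 1 < h \<Longrightarrow> q h j = 0"
    "\<And>j. j + 1 \<le> d \<Longrightarrow> q (j + 1) j \<noteq> 0"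
    by (rule Krein[OF assms]) (rule that)
  have rec: "q (j + 1) j * E (j + 1) $ u $ x
      = of_nat CARD('a) * (E 1 $ u $ x * E j $ u $ x) - (\<Sum>h\<le>j. q h j * E h $ u $ x)"
    if j: "j + 1 \<le> d" for j x
  proof -
    have "(\<Sum>h\<le>d. q h j * E h $ u $ x) = (\<Sum>h\<le>j + 1. q h j * E h $ u $ x)"
      using j q(2)[of _ j] by (intro sum.mono_neutral_right) auto
    also have "\<dots> = (\<Sum>h\<le>j. q h j * E h $ u $ x) + q (j + 1) j * E (j + 1) $ u $ x"
      by simp
    moreover have "of_nat CARD('a) * (E 1 $ u $ x * E j $ u $ x) = (\<Sum>h\<le>d. q h j * E h $ u $ x)"
      using q(1)[of j u x] j by simp
    ultimately show ?thesis by simp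
  qed
  have 1: "E 1 $ u $ y = E 1 $ u $ z"
    using kl assms by (simp add: E_nth y z)
  have all: "E j $ u $ y = E j $ u $ z" if "j \<le> d" for j
    using that
  proof (induction j rule: less_induct)
    case (less j)
    show ?case
    proof (cases j)
      case 0
      then show ?thesis by (simp add: E_0)
    next
      case (Suc i)
      have "(\<Sum>h\<le>i. q h i * E h $ u $ y) = (\<Sum>h\<le>i. q h i * E h $ u $ z)"
        using less Suc by (intro sum.cong) auto
      moreover have "E i $ u $ y = E i $ u $ z"
        using less Suc by simp
      ultimately have "q (i + 1) i * E (i + 1) $ u $ y = q (i + 1) i * E (i + 1) $ u $ z"
        using rec[of i] less.prems Suc 1 by simp
      moreover have "q (i + 1) i \<noteq> 0"
        using q(3) less.prems Suc by simp
      ultimately show ?thesis using Suc by simp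
    qed
  qed
  obtain c where c: "\<forall>x y. (if rel x y = k then 1 else 0) = (\<Sum>j\<le>d. c j * E j $ x $ y)"
    using function_of_rel_in_span[of "\<lambda>h. if h = k then 1 else 0"] by blast
  have "(\<Sum>j\<le>d. c j * E j $ u $ y) = (\<Sum>j\<le>d. c j * E j $ u $ z)"
    using all by (intro sum.cong) auto
  then have "(if rel u y = k then 1 else 0) = (if rel u z = k then 1 else 0 :: complex)"
    by (simp only: c)
  then show "k = l"
    using y z by (auto split: if_splits)
qed

text \<open>The sum is an entry of \<open>E i ** D ** E j\<close>, where \<open>D\<close> carries
  row \<open>u\<close> of \<open>E 1\<close> on its diagonal. Summing squared moduli over
  \<open>u\<close> as well as \<open>y\<close> and \<open>z\<close> turns each pair of factors into
  a single entry of \<open>E i\<close>, \<open>E 1\<close> or \<open>E j\<close>; the total is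
  \<open>q i j\<close> times the trace of \<open>E i\<close>, divided by the number of vertices, and
  \<open>q i j = 0\<close>.\<close>

lemma vanishing_triple_product:
  assumes d: "1 \<le> d" and ij: "i \<le> d" "j \<le> d" "j + 1 < i"
  shows "(\<Sum>x\<in>UNIV. E i $ y $ x * E 1 $ u $ x * E j $ x $ z) = 0"
proof -
  let ?F = "\<lambda>u y z. \<Sum>x\<in>UNIV. E i $ y $ x * E 1 $ u $ x * E j $ x $ z"
  obtain q where q:
    "\<And>j x y. j \<le> d \<Longrightarrow> E 1 $ x $ y * E j $ x $ y = (\<Sum>h\<le>d. q h j * E h $ x $ y) / of_nat CARD('a)"
    "\<And>h j. h \<le> d \<Longrightarrow> j \<le> d \<Longrightarrow> j + 1 < h \<Longrightarrow> q h j = 0"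
    "\<And>j. j + 1 \<le> d \<Longrightarrow> q (j + 1) j \<noteq> 0"
    by (rule Krein[OF d]) (rule that)
  have EE: "(\<Sum>y\<in>UNIV. E h $ x $ y * E k $ y $ x') = (if h = k then E h $ x $ x' else 0)"
    if "h \<le> d" "k \<le> d" for h k x x'
    using arg_cong[OF E_mult[OF that], of "\<lambda>M. M $ x $ x'"] by (auto simp: matrix_matrix_mult_def)
  have EE': "(\<Sum>y\<in>UNIV. E h $ y $ x * E h $ y $ x') = E h $ x $ x'" (is "?l1 = _")
      "(\<Sum>y\<in>UNIV. E h $ x $ y * E h $ x' $ y) = E h $ x $ x'" (is "?l2 = _") if "h \<le> d" for h x x'
  proof -
    have "?l1 = (\<Sum>y\<in>UNIV. E h $ x $ y * E h $ y $ x')"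
      by (intro sum.cong refl arg_cong2[where f = "(*)"] E_nth_commute that)
    then show "?l1 = E h $ x $ x'" using EE[OF that that] by simp
    have "?l2 = (\<Sum>y\<in>UNIV. E h $ x $ y * E h $ y $ x')"
      by (intro sum.cong refl arg_cong2[where f = "(*)"] E_nth_commute that)
    then show "?l2 = E h $ x $ x'" using EE[OF that that] by simp
  qed
  \<comment> \<open>The entries are real, so the squared modulus is a plain square; as a double sum
    it lets the sums over \<open>y\<close>, \<open>u\<close> and \<open>z\<close> act on separate
    factors.\<close>
  have norm2: "of_real ((cmod (?F u y z))\<^sup>2) = (\<Sum>x\<in>UNIV. \<Sum>x'\<in>UNIV.
      (E i $ y $ x * E i $ y $ x') * (E 1 $ u $ x * E 1 $ u $ x') * (E j $ x $ z * E j $ x' $ z))"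
    for u y z
  proof -
    have "cnj (?F u y z) = ?F u y z"
      using ij d by (simp add: E_real)
    then have "of_real ((cmod (?F u y z))\<^sup>2) = ?F u y z * ?F u y z"
      using complex_norm_square[of "?F u y z"] by simp
    then show ?thesis
      by (simp add: sum_product mult_ac)
  qed
  have "(\<Sum>u\<in>UNIV. \<Sum>y\<in>UNIV. \<Sum>z\<in>UNIV. of_real ((cmod (?F u y z))\<^sup>2))
      = (\<Sum>x\<in>UNIV. \<Sum>x'\<in>UNIV. (\<Sum>y\<in>UNIV. E i $ y $ x * E i $ y $ x') *
          (\<Sum>u\<in>UNIV. E 1 $ u $ x * E 1 $ u $ x') * (\<Sum>z\<in>UNIV. E j $ x $ z * E j $ x' $ z))"
    (is "?lhs = _")
  proof -
    have swap3: "(\<Sum>x\<in>UNIV. \<Sum>x'\<in>UNIV. (\<Sum>y\<in>UNIV. f y x x') * (\<Sum>u\<in>UNIV. g u x x') * (\<Sum>z\<in>UNIV. h z x x'))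
      = (\<Sum>u\<in>UNIV. \<Sum>y\<in>UNIV. \<Sum>z\<in>UNIV. \<Sum>x\<in>UNIV. \<Sum>x'\<in>UNIV. f y x x' * g u x x' * h z x x')"
      for f g h :: "'a \<Rightarrow> 'a \<Rightarrow> 'a \<Rightarrow> complex"
    proof -
      have prod3: "(\<Sum>y\<in>UNIV. f y x x') * (\<Sum>u\<in>UNIV. g u x x') * (\<Sum>z\<in>UNIV. h z x x')
          = (\<Sum>u\<in>UNIV. \<Sum>y\<in>UNIV. \<Sum>z\<in>UNIV. f y x x' * g u x x' * h z x x')" for x x'
        by (simp only: sum_distrib_left[symmetric] sum_distrib_right[symmetric])
      have pull: "(\<Sum>x\<in>UNIV. \<Sum>u\<in>UNIV. \<Sum>y\<in>UNIV. \<Sum>z\<in>UNIV. k u y z x)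
          = (\<Sum>u\<in>UNIV. \<Sum>y\<in>UNIV. \<Sum>z\<in>UNIV. \<Sum>x\<in>UNIV. k u y z x)"
        for k :: "'a \<Rightarrow> 'a \<Rightarrow> 'a \<Rightarrow> 'a \<Rightarrow> complex"
        by (subst sum.swap, rule sum.cong[OF refl], subst sum.swap, rule sum.cong[OF refl], rule sum.swap)
      show ?thesis
        unfolding prod3 by (rule trans[OF sum.cong[OF refl pull] pull])
    qed
    show ?thesis unfolding norm2 swap3 ..
  qed
  also have "\<dots> = (\<Sum>x\<in>UNIV. \<Sum>x'\<in>UNIV. E i $ x $ x' * (E 1 $ x $ x' * E j $ x $ x'))"
    using ij d by (simp add: EE' mult.assoc)
  also have "\<dots> = (\<Sum>x\<in>UNIV. \<Sum>x'\<in>UNIV. (\<Sum>h\<le>d. q h j * (E i $ x $ x' * E h $ x' $ x))) / of_nat CARD('a)"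
  proof -
    have "E i $ x $ x' * (E 1 $ x $ x' * E j $ x $ x')
        = (\<Sum>h\<le>d. q h j * (E i $ x $ x' * E h $ x' $ x)) / of_nat CARD('a)" for x x'
    proof -
      have "(\<Sum>h\<le>d. q h j * (E i $ x $ x' * E h $ x' $ x)) = E i $ x $ x' * (\<Sum>h\<le>d. q h j * E h $ x $ x')"
        unfolding sum_distrib_left by (intro sum.cong) (simp_all add: E_nth_commute[of _ x' x])
      then show ?thesis unfolding q(1)[OF ij(2)] by simp
    qed
    then show ?thesis by (simp add: sum_divide_distrib)
  qed
  also have "\<dots> = (\<Sum>x\<in>UNIV. \<Sum>h\<le>d. q h j * (\<Sum>x'\<in>UNIV. E i $ x $ x' * E h $ x' $ x)) / of_nat CARD('a)"
    unfolding sum_distrib_left by (intro arg_cong2[where f = "(/)"] sum.cong refl sum.swap)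
  \<comment> \<open>Orthogonality of the idempotents leaves only the term
    \<open>h = i\<close>.\<close>
  also have "\<dots> = (\<Sum>x\<in>UNIV. \<Sum>h\<le>d. (if h = i then q i j * E i $ x $ x else 0)) / of_nat CARD('a)"
    using ij by (intro arg_cong2[where f = "(/)"] sum.cong refl) (auto simp: EE)
  also have "\<dots> = 0"
    using ij q(2) by simp
  finally have "?lhs = 0" .
  then have "(\<Sum>u\<in>UNIV. \<Sum>y\<in>UNIV. \<Sum>z\<in>UNIV. (cmod (?F u y z))\<^sup>2) = 0"
    unfolding of_real_sum[symmetric] of_real_eq_0_iff .
  then have "(cmod (?F u y z))\<^sup>2 = 0"
    by (simp add: sum_nonneg_eq_0_iff sum_nonneg)
  then show ?thesis by simp
qed

text \<open>The matrix of \<^term>\<open>weighted_power (\<lambda>x. \<theta> (rel u0 x)) 1\<close> is the dual adjacency matrix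
  up to scaling.\<close>

lemma dual_eigenvalues:
  obtains \<theta> :: "nat \<Rightarrow> complex" where "inj_on \<theta> {..d}"
    and "\<And>u0 i j v. i \<le> d \<Longrightarrow> j \<le> d \<Longrightarrow> j + 1 < i \<Longrightarrow>
      E i *v weighted_power (\<lambda>x. \<theta> (rel u0 x)) 1 (E j *v v) = 0"
proof (cases "1 \<le> d")
  case True
  show thesis
  proof (rule that[of "Q 1"])
    show "inj_on (Q 1) {..d}" using inj_on_Q_1 True .
    fix u0 i j v assume ij: "i \<le> d" "j \<le> d" "j + 1 < i"
    have "(E i *v weighted_power (\<lambda>x. Q 1 (rel u0 x)) 1 (E j *v v)) $ y = 0" for y
    proof -
      have "(E i *v weighted_power (\<lambda>x. Q 1 (rel u0 x)) 1 (E j *v v)) $ y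
          = (\<Sum>x\<in>UNIV. \<Sum>z\<in>UNIV. E i $ y $ x * E 1 $ u0 $ x * E j $ x $ z * v $ z)"
        using True by (simp add: matrix_vector_mult_def weighted_power_def E_nth[OF True, unfolded One_nat_def] sum_distrib_left mult.assoc)
      also have "\<dots> = (\<Sum>z\<in>UNIV. (\<Sum>x\<in>UNIV. E i $ y $ x * E 1 $ u0 $ x * E j $ x $ z) * v $ z)"
        by (subst sum.swap) (simp add: sum_distrib_right)
      finally show ?thesis using vanishing_triple_product[OF True ij] by simp
    qed
    then show "E i *v weighted_power (\<lambda>x. Q 1 (rel u0 x)) 1 (E j *v v) = 0"
      by (simp add: vec_eq_iff)
  qed
next
  case False
  \<comment> \<open>Here \<open>d = 0\<close>, so no \<open>i\<close> and \<open>j\<close> satisfy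
    \<open>i \<le> d\<close> and \<open>j + 1 < i\<close>, and any injective choice serves.\<close>
  then show thesis by (intro that[of of_nat]) (auto simp: inj_on_def)
qed

end

section \<open>Submodules of the Terwilliger algebra\<close>

definition hermitian_adjoint :: "complex^'n^'m \<Rightarrow> complex^'m^'n" where
  "hermitian_adjoint M = (\<chi> x y. cnj (M $ y $ x))"

lemma inner_complex_vec: "inner x y = Re (\<Sum>i\<in>UNIV. x $ i * cnj (y $ i))" for x y :: "complex^'n"
  by (simp add: inner_vec_def inner_complex_def)

lemma inner_hermitian_adjoint:
  "inner (M *v x) y = inner x (hermitian_adjoint M *v y)" for M :: "complex^'n^'m"
proof -
  have "(\<Sum>i\<in>UNIV. (M *v x) $ i * cnj (y $ i))
      = (\<Sum>i\<in>UNIV. \<Sum>j\<in>UNIV. M $ i $ j * x $ j * cnj (y $ i))"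
    by (simp add: matrix_vector_mult_def sum_distrib_right)
  also have "\<dots> = (\<Sum>j\<in>UNIV. \<Sum>i\<in>UNIV. M $ i $ j * x $ j * cnj (y $ i))"
    by (rule sum.swap)
  also have "\<dots> = (\<Sum>j\<in>UNIV. x $ j * cnj ((hermitian_adjoint M *v y) $ j))"
    by (simp add: matrix_vector_mult_def hermitian_adjoint_def sum_distrib_left mult_ac)
  finally show ?thesis by (simp only: inner_complex_vec)
qed

lemma inner_scale_complex_vec: "inner x (c *s y) = inner (cnj c *s x) y" for x y :: "complex^'n"
  by (simp add: inner_complex_vec mult_ac)

text \<open>Makes the real orthogonal decomposition theorem applicable to complex subspaces.\<close>

lemma subspace_of_vec_subspace:
  fixes W :: "(complex^'n) set"
  assumes "vec.subspace W"
  shows "subspace W"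
proof -
  have "r *\<^sub>R x = complex_of_real r *s x" for r and x :: "complex^'n"
    unfolding vec_eq_iff vector_scaleR_component vector_smult_component
    by (simp add: scaleR_conv_of_real)
  with assms show ?thesis
    unfolding subspace_def vec.subspace_def by auto
qed

lemma hermitian_adjoint_mult:
  "hermitian_adjoint (M ** N) = hermitian_adjoint N ** hermitian_adjoint M"
  by (simp add: hermitian_adjoint_def matrix_matrix_mult_def vec_eq_iff mult.commute)

text \<open>The generators are real symmetric matrices. Closure under adjoints is what makes
  orthogonal complements of submodules invariant.\<close>

lemma hermitian_adjoint_terwilliger:
  fixes rel :: "'a::finite \<Rightarrow> 'a \<Rightarrow> nat"
  assumes sym: "\<And>x y. rel x y = rel y x" and "M \<in> terwilliger d rel u0"
  shows "hermitian_adjoint M \<in> terwilliger d rel u0"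
  using assms(2)
proof induction
  case (gen_A i)
  have "hermitian_adjoint (adj rel i) = adj rel i"
    unfolding hermitian_adjoint_def adj_def vec_eq_iff using sym by auto
  with gen_A show ?case by (simp add: terwilliger.gen_A)
next
  case (gen_Es i)
  have "hermitian_adjoint (dual_idem rel u0 i) = dual_idem rel u0 i"
    by (auto simp: hermitian_adjoint_def dual_idem_def vec_eq_iff)
  with gen_Es show ?case by (simp add: terwilliger.gen_Es)
next
  case one
  have "hermitian_adjoint (mat 1) = (mat 1 :: complex^'a^'a)"
    by (auto simp: hermitian_adjoint_def mat_def vec_eq_iff)
  then show ?case by (simp add: terwilliger.one)
next
  case (add M N)
  have "hermitian_adjoint (M + N) = hermitian_adjoint M + hermitian_adjoint N"
    by (simp add: hermitian_adjoint_def vec_eq_iff)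
  with add show ?case by (simp add: terwilliger.add)
next
  case (smult M c)
  have "hermitian_adjoint (\<chi> x y. c * M $ x $ y) = (\<chi> x y. cnj c * hermitian_adjoint M $ x $ y)"
    by (simp add: hermitian_adjoint_def vec_eq_iff)
  with smult show ?case by (simp add: terwilliger.smult)
next
  case (mult M N)
  then show ?case by (simp add: hermitian_adjoint_mult terwilliger.mult)
qed

lemma matrix_scale_vector_mult: "(\<chi> x y. c * M $ x $ y) *v u = c *s (M *v u)"
  for M :: "'b::field^'n^'m"
  by (simp add: matrix_vector_mult_def vec_eq_iff sum_distrib_left mult.assoc)

lemma T_invariant_terwilligerI:
  assumes U: "vec.subspace U"
    and A: "\<And>i u. i \<le> d \<Longrightarrow> u \<in> U \<Longrightarrow> adj rel i *v u \<in> U"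
    and Es: "\<And>i u. i \<le> d \<Longrightarrow> u \<in> U \<Longrightarrow> dual_idem rel u0 i *v u \<in> U"
  shows "T_invariant (terwilliger d rel u0) U"
  unfolding T_invariant_def
proof
  fix M assume "M \<in> terwilliger d rel u0"
  then show "\<forall>u\<in>U. M *v u \<in> U"
  proof induction
    case (add M N)
    then show ?case
      using U by (simp add: matrix_vector_mult_add_rdistrib vec.subspace_add)
  next
    case (smult M c)
    then show ?case
      using U by (simp add: matrix_scale_vector_mult vec.subspace_scale)
  next
    case (mult M N)
    then show ?case by (simp add: matrix_vector_mul_assoc[symmetric])
  qed (use A Es in auto)
qed

text \<open>The library inner product on complex vectors is the real part of the Hermitian form; for a
  complex subspace both give the same orthogonal complement.\<close>

lemma invariant_orthogonal_complement:
  fixes U W :: "(complex^'n) set"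
  assumes T: "\<And>M. M \<in> T \<Longrightarrow> hermitian_adjoint M \<in> T"
    and U: "vec.subspace U" "T_invariant T U" and W: "vec.subspace W" "T_invariant T W" "W \<subseteq> U"
  obtains W' where "vec.subspace W'" "T_invariant T W'" "W' \<subseteq> U" "W \<inter> W' = {0}"
    "U = {x + y |x y. x \<in> W \<and> y \<in> W'}"
proof
  let ?W' = "{u \<in> U. \<forall>w\<in>W. inner w u = 0}"
  show "vec.subspace ?W'"
    using U(1) W(1) unfolding vec.subspace_def by (auto simp: inner_add_right inner_scale_complex_vec)
  show "T_invariant T ?W'"
    unfolding T_invariant_def
  proof (intro ballI CollectI conjI)
    fix M u assume Mu: "M \<in> T" "u \<in> ?W'"
    then show "M *v u \<in> U" using U(2) unfolding T_invariant_def by blast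
    fix w assume "w \<in> W"
    \<comment> \<open>Invariance of the complement: \<open>M\<close> is moved to the other argument,
      where its adjoint keeps \<open>w\<close> in \<open>W\<close>.\<close>
    then have "hermitian_adjoint M *v w \<in> W"
      using T Mu(1) W(2) unfolding T_invariant_def by blast
    then have "inner (hermitian_adjoint M *v w) u = 0" using Mu(2) by blast
    then show "inner w (M *v u) = 0"
      by (metis inner_commute inner_hermitian_adjoint)
  qed
  show "?W' \<subseteq> U" by blast
  show "W \<inter> ?W' = {0}"
    using vec.subspace_0[OF W(1)] vec.subspace_0[OF U(1)] by auto
  show "U = {x + y |x y. x \<in> W \<and> y \<in> ?W'}"
  proof (intro subset_antisym subsetI)
    fix u assume u: "u \<in> U"
    \<comment> \<open>\<open>span\<close> is the real span; a complex subspace is its own real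
      span.\<close>
    obtain y z where yz: "y \<in> span W" "\<And>w. w \<in> span W \<Longrightarrow> orthogonal z w" "u = y + z"
      using orthogonal_subspace_decomp_exists[of W u] by metis
    have span: "span W = W"
      using subspace_of_vec_subspace[OF W(1)] by (simp add: span_eq_iff)
    have "z = u - y" using yz(3) by simp
    then have "z \<in> U" using u yz(1) span W(3) vec.subspace_diff[OF U(1)] by blast
    then have "z \<in> ?W'"
      using yz(2) span by (simp add: orthogonal_def inner_commute)
    with yz(1,3) span show "u \<in> {x + y |x y. x \<in> W \<and> y \<in> ?W'}" by blast
  next
    fix u assume "u \<in> {x + y |x y. x \<in> W \<and> y \<in> ?W'}"
    then show "u \<in> U" using W(3) vec.subspace_add[OF U(1)] by blast
  qed
qed

text \<open>A nonzero invariant subspace of least dimension is irreducible.\<close>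

lemma exists_irreducible_submodule:
  assumes U: "vec.subspace U" "T_invariant T U" "U \<noteq> {0}"
  obtains W where "irreducible_module T W" "W \<subseteq> U"
proof -
  let ?P = "\<lambda>W. vec.subspace W \<and> W \<noteq> {0} \<and> T_invariant T W \<and> W \<subseteq> U"
  have "?P U" using U by blast
  from ex_has_least_nat[of ?P, OF this, of vec.dim]
  obtain W where W: "?P W" and least: "\<And>V. ?P V \<Longrightarrow> vec.dim W \<le> vec.dim V"
    by blast
  have "irreducible_module T W"
    unfolding irreducible_module_def
  proof (intro conjI allI impI)
    fix V assume V: "vec.subspace V \<and> V \<subseteq> W \<and> T_invariant T V"
    show "V = {0} \<or> V = W"
      using V W least[of V] vec.subspace_dim_equal[of V W] by blast
  qed (use W in auto)
  with W that show thesis by blast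
qed

text \<open>As \<open>f\<close> maps each summand into itself, the two images still meet only in 0.
  This makes both sides of the dimension formula additive over submodules.\<close>

lemma dim_linear_image_direct_sum:
  fixes f :: "'b::field^'n \<Rightarrow> 'b^'n"
  assumes f: "Vector_Spaces.linear (*s) (*s) f"
    and W: "vec.subspace W" "f ` W \<subseteq> W" and W': "vec.subspace W'" "f ` W' \<subseteq> W'" and "W \<inter> W' = {0}"
  shows "vec.dim (f ` {x + y |x y. x \<in> W \<and> y \<in> W'}) = vec.dim (f ` W) + vec.dim (f ` W')"
proof -
  interpret f: Vector_Spaces.linear "(*s)" "(*s)" f by fact
  have "f ` {x + y |x y. x \<in> W \<and> y \<in> W'} = {x + y |x y. x \<in> f ` W \<and> y \<in> f ` W'}"
  proof
    show "{x + y |x y. x \<in> f ` W \<and> y \<in> f ` W'} \<subseteq> f ` {x + y |x y. x \<in> W \<and> y \<in> W'}"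
      by (clarsimp simp: f.add[symmetric]) blast
  qed (fastforce simp: f.add)
  moreover have sub: "vec.subspace (f ` W)" "vec.subspace (f ` W')"
    using W W' f.subspace_image by blast+
  moreover have "f ` W \<inter> f ` W' = {0}"
    using assms vec.subspace_0[OF sub(1)] vec.subspace_0[OF sub(2)] by blast
  ultimately show ?thesis
    using vec.dim_sums_Int[OF sub] by simp
qed

lemma linear_restrict_vec: "Vector_Spaces.linear (*s) (*s) (restrict_vec S)"
  by unfold_locales (auto simp: restrict_vec_def vec_eq_iff)

section \<open>The dual filtration of a module\<close>

context Q_polynomial_scheme
begin

text \<open>The \<open>E i\<close> and the adjacency matrices span the same space, so either family
  can be used as generators together with the dual idempotents.\<close>

lemma T_invariant_terwilliger_iff:
  assumes U: "vec.subspace U"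
  shows "T_invariant (terwilliger d rel u0) U \<longleftrightarrow>
    (\<forall>i\<le>d. \<forall>u\<in>U. E i *v u \<in> U \<and> dual_idem rel u0 i *v u \<in> U)"
proof
  assume inv: "T_invariant (terwilliger d rel u0) U"
  show "\<forall>i\<le>d. \<forall>u\<in>U. E i *v u \<in> U \<and> dual_idem rel u0 i *v u \<in> U"
  proof (intro allI impI ballI conjI)
    fix i u assume i: "i \<le> d" and u: "u \<in> U"
    show "dual_idem rel u0 i *v u \<in> U"
      using inv i u terwilliger.gen_Es unfolding T_invariant_def by blast
    have "E i $ x $ y = (\<Sum>k\<le>d. Q i k * adj rel k $ x $ y)" for x y
      using i rel_le[of x y]
      by (simp add: E_nth adj_nth if_distrib[where f = "\<lambda>a. _ * a"] cong: if_cong)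
    then have "E i *v u = (\<Sum>k\<le>d. Q i k *s (adj rel k *v u))"
      by (rule matrix_vector_mult_linear_combination)
    also have "\<dots> \<in> U"
    proof (intro vec.subspace_sum[OF U] vec.subspace_scale[OF U])
      fix k assume "k \<in> {..d}"
      then show "adj rel k *v u \<in> U"
        using inv u terwilliger.gen_A[of k d rel u0] unfolding T_invariant_def by simp
    qed
    finally show "E i *v u \<in> U" .
  qed
next
  assume inv: "\<forall>i\<le>d. \<forall>u\<in>U. E i *v u \<in> U \<and> dual_idem rel u0 i *v u \<in> U"
  show "T_invariant (terwilliger d rel u0) U"
  proof (rule T_invariant_terwilligerI[OF U])
    fix i u assume i: "i \<le> d" and u: "u \<in> U"
    obtain c where "\<forall>v. adj rel i *v v = (\<Sum>j\<le>d. c j *s (E j *v v))"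
      using adj_vec_in_span[of i] by blast
    then have "adj rel i *v u = (\<Sum>j\<le>d. c j *s (E j *v u))" by blast
    also have "\<dots> \<in> U"
      using inv u by (intro vec.subspace_sum[OF U] vec.subspace_scale[OF U]) simp
    finally show "adj rel i *v u \<in> U" .
  qed (use inv in blast)
qed

text \<open>For a submodule \<open>W\<close> this is the sum of the \<open>E i W\<close> with
  \<open>i \<le> K\<close>. Stating it by vanishing higher components gives a meaning for
  \<open>K > d\<close> too, namely all of \<open>W\<close>.\<close>

definition filtration :: "(complex^'a) set \<Rightarrow> nat \<Rightarrow> (complex^'a) set" where
  "filtration W K = {w \<in> W. \<forall>i\<le>d. K < i \<longrightarrow> E i *v w = 0}"

lemma subspace_filtration: "vec.subspace W \<Longrightarrow> vec.subspace (filtration W K)"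
  unfolding vec.subspace_def filtration_def
  by (auto simp: vec.scale matrix_vector_right_distrib)

lemma filtration_mono: "K \<le> L \<Longrightarrow> filtration W K \<subseteq> filtration W L"
  by (auto simp: filtration_def)

lemma filtration_eq_sum:
  assumes "w \<in> filtration W K"
  shows "w = (\<Sum>i | i \<le> K \<and> i \<le> d. E i *v w)"
proof -
  have "(\<Sum>i\<le>d. E i *v w) = (\<Sum>i | i \<le> K \<and> i \<le> d. E i *v w)"
    using assms by (intro sum.mono_neutral_right) (auto simp: filtration_def)
  then show ?thesis by (simp add: E_sum_vec)
qed

text \<open>Subtracting the top component \<open>E (Suc K) *v w\<close> lowers the filtration level
  by one; once \<open>K\<close> reaches \<open>d\<close> both sides stay constant.\<close>

lemma dim_filtration_le:
  assumes W: "vec.subspace W" and EW: "\<And>i w. i \<le> d \<Longrightarrow> w \<in> W \<Longrightarrow> E i *v w \<in> W"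
  shows "vec.dim (filtration W K) \<le> (\<Sum>k | k \<le> K \<and> k \<le> d. vec.dim ((\<lambda>w. E k *v w) ` W))"
proof (induction K)
  case 0
  have "filtration W 0 \<subseteq> (\<lambda>w. E 0 *v w) ` W"
  proof
    fix w assume w: "w \<in> filtration W 0"
    have "{i. i \<le> 0 \<and> i \<le> d} = {0}" by auto
    then have "w = E 0 *v w" using filtration_eq_sum[OF w] by simp
    moreover have "w \<in> W" using w by (simp add: filtration_def)
    ultimately show "w \<in> (\<lambda>w. E 0 *v w) ` W" by blast
  qed
  moreover have "{k. k \<le> 0 \<and> k \<le> d} = {0}" by auto
  ultimately show ?case by (simp add: vec.dim_subset)
next
  case (Suc K)
  show ?case
  proof (cases "Suc K \<le> d")
    case True
    let ?S = "filtration W K" and ?T = "(\<lambda>w. E (Suc K) *v w) ` W"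
    have "filtration W (Suc K) \<subseteq> {x + y |x y. x \<in> ?S \<and> y \<in> ?T}"
    proof
      fix w assume w: "w \<in> filtration W (Suc K)"
      then have wW: "w \<in> W" by (simp add: filtration_def)
      have "w - E (Suc K) *v w \<in> ?S"
        unfolding filtration_def
      proof (intro CollectI conjI allI impI)
        show "w - E (Suc K) *v w \<in> W"
          using wW EW[OF True wW] by (rule vec.subspace_diff[OF W])
        fix i assume i: "i \<le> d" "K < i"
        then show "E i *v (w - E (Suc K) *v w) = 0"
          using w True by (cases "i = Suc K")
            (auto simp: filtration_def matrix_vector_mult_diff_distrib E_mult_vec)
      qed
      moreover have "w = (w - E (Suc K) *v w) + E (Suc K) *v w" by simp
      ultimately show "w \<in> {x + y |x y. x \<in> ?S \<and> y \<in> ?T}"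
        using wW by blast
    qed
    then have "vec.dim (filtration W (Suc K)) \<le> vec.dim ?S + vec.dim ?T"
      using dim_sums_le[OF subspace_filtration[OF W] vec.linear_subspace_image[OF matrix_vector_mul_linear_gen W]]
        vec.dim_subset order_trans by blast
    moreover have "{k. k \<le> Suc K \<and> k \<le> d} = insert (Suc K) {k. k \<le> K \<and> k \<le> d}"
      using True by auto
    ultimately show ?thesis using Suc by simp
  next
    case False
    then have "filtration W (Suc K) = filtration W K" "{k. k \<le> Suc K \<and> k \<le> d} = {k. k \<le> K \<and> k \<le> d}"
      by (auto simp: filtration_def less_Suc_eq le_Suc_eq)
    then show ?thesis using Suc by simp
  qed
qed

text \<open>\<open>E 0 + ... + E e\<close> is the projection onto the filtration step: it lands
  there and fixes every vector of it.\<close>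

lemma E_sum_image_eq_filtration:
  assumes W: "vec.subspace W" and EW: "\<And>i w. i \<le> d \<Longrightarrow> w \<in> W \<Longrightarrow> E i *v w \<in> W" and "e \<le> d"
  shows "(\<lambda>w. \<Sum>j\<le>e. E j *v w) ` W = filtration W e"
proof (intro subset_antisym subsetI)
  fix u assume "u \<in> (\<lambda>w. \<Sum>j\<le>e. E j *v w) ` W"
  then obtain w where w: "w \<in> W" "u = (\<Sum>j\<le>e. E j *v w)" by blast
  have "u \<in> W"
    unfolding w(2) using w(1) \<open>e \<le> d\<close> by (intro vec.subspace_sum[OF W] EW) auto
  moreover have "E i *v u = 0" if "i \<le> d" "e < i" for i
    unfolding w(2) using that by (simp add: vec.sum E_mult_vec)
  ultimately show "u \<in> filtration W e" by (simp add: filtration_def)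
next
  fix u assume u: "u \<in> filtration W e"
  have "{i. i \<le> e \<and> i \<le> d} = {..e}" using \<open>e \<le> d\<close> by auto
  with filtration_eq_sum[OF u] have "u = (\<Sum>j\<le>e. E j *v u)" by simp
  moreover have "u \<in> W" using u by (simp add: filtration_def)
  ultimately show "u \<in> (\<lambda>w. \<Sum>j\<le>e. E j *v w) ` W" by blast
qed

end

section \<open>The dual adjacency matrix acting on the filtration\<close>

locale dual_eigenvalue_scheme = Q_polynomial_scheme d rel E
  for d :: nat and rel :: "'a::finite \<Rightarrow> 'a \<Rightarrow> nat" and E :: "nat \<Rightarrow> complex^'a^'a" +
  fixes u0 :: 'a and \<theta> :: "nat \<Rightarrow> complex"
  assumes inj_\<theta>: "inj_on \<theta> {..d}"
    and tridiagonal: "\<And>i j v. i \<le> d \<Longrightarrow> j \<le> d \<Longrightarrow> j + 1 < i \<Longrightarrow>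
      E i *v weighted_power (\<lambda>x. \<theta> (rel u0 x)) 1 (E j *v v) = 0"
begin

abbreviation T :: "(complex^'a^'a) set" where
  "T \<equiv> terwilliger d rel u0"

abbreviation \<tau> :: "'a \<Rightarrow> complex" where
  "\<tau> \<equiv> \<lambda>x. \<theta> (rel u0 x)"

lemma linear_weighted_power: "Vector_Spaces.linear (*s) (*s) (weighted_power \<sigma> k)"
  by unfold_locales (auto simp: weighted_power_def vec_eq_iff algebra_simps)

text \<open>Distinct shells carry distinct eigenvalues, so the eigenvalue count in
  \<open>dim_krylov\<close> becomes a count of shells.\<close>

lemma card_\<tau>_image: "card (\<tau> ` A) = card (rel u0 ` A)"
proof -
  have "inj_on \<theta> (rel u0 ` A)"
    using inj_\<theta> by (rule inj_on_subset) (auto simp: rel_le)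
  then show ?thesis
    using card_image[of \<theta> "rel u0 ` A"] by (simp add: image_image)
qed

context
  fixes W assumes W: "vec.subspace W" and inv: "T_invariant T W"
begin

lemma E_in: "i \<le> d \<Longrightarrow> w \<in> W \<Longrightarrow> E i *v w \<in> W"
  and dual_idem_in: "i \<le> d \<Longrightarrow> w \<in> W \<Longrightarrow> dual_idem rel u0 i *v w \<in> W"
  using inv unfolding T_invariant_terwilliger_iff[OF W] by blast+

lemma weighted_power_in: "w \<in> W \<Longrightarrow> weighted_power \<tau> k w \<in> W"
  by (subst weighted_power_dual_idem[of rel u0 d, OF rel_le])
    (auto intro!: vec.subspace_sum[OF W] vec.subspace_scale[OF W] dual_idem_in)

text \<open>By \<open>tridiagonal\<close>, \<open>D\<close> raises the filtration level by at most
  one.\<close>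

lemma weighted_power_filtration:
  assumes "w \<in> filtration W K"
  shows "weighted_power \<tau> 1 w \<in> filtration W (Suc K)"
  unfolding filtration_def
proof (intro CollectI conjI allI impI)
  show "weighted_power \<tau> 1 w \<in> W"
    using assms weighted_power_in by (simp add: filtration_def)
  fix i assume i: "i \<le> d" "Suc K < i"
  interpret D: Vector_Spaces.linear "(*s)" "(*s)" "weighted_power \<tau> 1 :: complex^'a \<Rightarrow> complex^'a"
    by (rule linear_weighted_power)
  have "weighted_power \<tau> 1 w = (\<Sum>j | j \<le> K \<and> j \<le> d. weighted_power \<tau> 1 (E j *v w))"
    by (subst filtration_eq_sum[OF assms]) (rule D.sum)
  then have "E i *v weighted_power \<tau> 1 w
      = (\<Sum>j | j \<le> K \<and> j \<le> d. E i *v weighted_power \<tau> 1 (E j *v w))"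
    by (simp only: vec.sum)
  also have "\<dots> = 0"
    using i by (intro sum.neutral ballI tridiagonal) auto
  finally show "E i *v weighted_power \<tau> 1 w = 0" .
qed

lemma krylov_subset_filtration:
  assumes w: "w \<in> filtration W \<rho>" and "n \<le> Suc k"
  shows "krylov \<tau> w n \<subseteq> filtration W (\<rho> + k)"
proof -
  have "weighted_power \<tau> m w \<in> filtration W (\<rho> + m)" for m
  proof (induction m)
    case 0
    have "weighted_power \<tau> 0 w = w" by (simp add: weighted_power_def vec_eq_iff)
    with w show ?case by simp
  next
    case (Suc m)
    then show ?case
      using weighted_power_filtration[OF Suc] by (subst weighted_power_Suc) simp
  qed
  moreover have "filtration W (\<rho> + m) \<subseteq> filtration W (\<rho> + k)" if "m < n" for m
    using that assms(2) by (intro filtration_mono) simp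
  ultimately show ?thesis
    unfolding krylov_def
    by (intro vec.span_minimal subspace_filtration[OF W] image_subsetI) auto
qed

end

end

section \<open>Irreducible modules and the dimension count\<close>

text \<open>\<open>rank\<close> is defined through rows, while the image is the column space; for a
  symmetric matrix the two agree.\<close>

lemma rank_symmetric:
  fixes M :: "'b::field^'n^'n"
  assumes "\<And>x y. M $ x $ y = M $ y $ x"
  shows "rank M = vec.dim (range (\<lambda>v. M *v v))"
proof -
  have rows: "rows M = columns M"
    using assms by (auto simp: rows_def columns_def row_def column_def)
  have "range (\<lambda>v. M *v v) = vec.span (columns M)"
  proof
    show "range (\<lambda>v. M *v v) \<subseteq> vec.span (columns M)"
      using matrix_vector_mult_in_columnspace_gen by blast
    have "columns M \<subseteq> range (\<lambda>v. M *v v)"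
    proof
      fix c assume "c \<in> columns M"
      then obtain k where "c = column k M" by (auto simp: columns_def)
      then have "c = M *v axis k 1"
        by (simp add: vec_eq_iff column_def matrix_vector_mult_axis)
      then show "c \<in> range (\<lambda>v. M *v v)" by blast
    qed
    then show "vec.span (columns M) \<subseteq> range (\<lambda>v. M *v v)"
      by (intro vec.span_minimal vec.linear_subspace_image) auto
  qed
  then show ?thesis
    by (simp add: row_rank_def_gen rows vec.dim_span)
qed

lemma below_dual_endpoint:
  assumes "k < dual_endpoint E W"
  shows "w \<in> W \<Longrightarrow> E k *v w = 0" and "vec.dim ((\<lambda>w. E k *v w) ` W) = 0"
proof -
  show *: "E k *v w = 0" if "w \<in> W" for w
    using not_less_Least[of k "\<lambda>i. \<exists>w\<in>W. E i *v w \<noteq> 0"] assms that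
    unfolding dual_endpoint_def by blast
  then have "(\<lambda>w. E k *v w) ` W \<subseteq> {0}" by blast
  then show "vec.dim ((\<lambda>w. E k *v w) ` W) = 0"
    by (simp add: vec.dim_eq_0)
qed

lemma linear_restrict_sum: "Vector_Spaces.linear (*s) (*s) (\<lambda>w. restrict_vec S (\<Sum>j\<in>J. E j *v w))"
proof -
  interpret R: Vector_Spaces.linear "(*s)" "(*s)" "restrict_vec S"
    by (rule linear_restrict_vec)
  show ?thesis
    by unfold_locales
      (simp_all add: vec.add vec.scale sum.distrib vec.scale_sum_right[symmetric] R.add R.scale)
qed

context dual_eigenvalue_scheme
begin

lemma restrict_krylov: "restrict_vec S ` krylov \<sigma> w n = krylov \<sigma> (restrict_vec S w) n"
proof -
  have "restrict_vec S (weighted_power \<sigma> k w) = weighted_power \<sigma> k (restrict_vec S w)" for k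
    by (simp add: restrict_vec_def weighted_power_def vec_eq_iff)
  then show ?thesis
    unfolding krylov_def
    by (simp add: vec.linear_span_image[OF linear_restrict_vec, symmetric] image_image)
qed

text \<open>Let \<open>w\<close> be a nonzero vector of \<open>E \<rho> W\<close> with
  \<open>\<rho>\<close> the dual endpoint, meeting \<open>s\<close> shells. Its Krylov space of
  length \<open>s\<close> equals, by dimension, both the span of the shell components of
  \<open>w\<close> and a step of the filtration of \<open>W\<close>. It is therefore a nonzero
  submodule, hence all of \<open>W\<close>.\<close>

lemma irreducible_module_structure:
  assumes irr: "irreducible_module T W" and thin: "dual_thin d E W"
  obtains w where "w \<in> filtration W (dual_endpoint E W)"
    "W = vec.span ((\<lambda>i. dual_idem rel u0 i *v w) ` {..d})"
    "rel u0 ` {x. w $ x \<noteq> 0} \<noteq> {}"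
proof -
  let ?\<rho> = "dual_endpoint E W"
  have W: "vec.subspace W" and W0: "W \<noteq> {0}" and inv: "T_invariant T W"
    and min: "\<And>U. vec.subspace U \<Longrightarrow> U \<subseteq> W \<Longrightarrow> T_invariant T U \<Longrightarrow> U = {0} \<or> U = W"
    using irr unfolding irreducible_module_def by blast+
  note E_in = E_in[OF W inv] and dual_idem_in = dual_idem_in[OF W inv]
  have ex: "\<exists>w\<in>W. E ?\<rho> *v w \<noteq> 0" and \<rho>: "?\<rho> \<le> d"
  proof -
    obtain v where v: "v \<in> W" "v \<noteq> 0"
      using W0 vec.subspace_0[OF W] by blast
    then have "\<exists>i\<le>d. E i *v v \<noteq> 0"
      using E_sum_vec[of v] by (metis (no_types, lifting) atMost_iff sum.neutral)
    then obtain i where i: "i \<le> d" "\<exists>w\<in>W. E i *v w \<noteq> 0" using v by blast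
    show "\<exists>w\<in>W. E ?\<rho> *v w \<noteq> 0"
      unfolding dual_endpoint_def by (rule LeastI[of "\<lambda>i. \<exists>w\<in>W. E i *v w \<noteq> 0", OF i(2)])
    have "?\<rho> \<le> i"
      unfolding dual_endpoint_def by (rule Least_le) (rule i(2))
    then show "?\<rho> \<le> d" using i(1) by simp
  qed
  then obtain v where v: "v \<in> W" "E ?\<rho> *v v \<noteq> 0" by blast
  define w where "w = E ?\<rho> *v v"
  have wW: "w \<in> W" and w0: "w \<noteq> 0"
    using v E_in \<rho> by (simp_all add: w_def)
  have wf: "w \<in> filtration W ?\<rho>"
    using wW \<rho> by (auto simp: filtration_def w_def E_mult_vec)
  let ?I = "rel u0 ` {x. w $ x \<noteq> 0}"
  let ?s = "card ?I"
  let ?B = "vec.span ((\<lambda>i. dual_idem rel u0 i *v w) ` {..d})"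
  have I: "?I \<noteq> {}" using w0 by (auto simp: vec_eq_iff)
  then have s: "?s \<ge> 1" by (simp add: Suc_le_eq card_gt_0_iff)
  have dimK: "vec.dim (krylov \<tau> w ?s) = ?s"
    by (simp add: dim_krylov card_\<tau>_image)
  have "weighted_power \<tau> k w \<in> ?B" for k
    unfolding weighted_power_dual_idem[of rel u0 d \<theta>, OF rel_le]
    by (intro vec.span_sum vec.span_scale vec.span_base imageI)
  then have "krylov \<tau> w ?s \<subseteq> ?B"
    unfolding krylov_def by (intro vec.span_minimal vec.subspace_span image_subsetI)
  moreover have "vec.dim ?B \<le> ?s"
  proof -
    have "dual_idem rel u0 i *v w \<in> vec.span ((\<lambda>i. dual_idem rel u0 i *v w) ` ?I)" for i
    proof (cases "i \<in> ?I")
      case False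
      then have "dual_idem rel u0 i *v w = 0"
        by (auto simp: vec_eq_iff dual_idem_vec_nth)
      then show ?thesis by (simp add: vec.span_zero)
    qed (auto intro: vec.span_base)
    then have "?B \<subseteq> vec.span ((\<lambda>i. dual_idem rel u0 i *v w) ` ?I)"
      by (intro vec.span_minimal vec.subspace_span) blast
    then have "vec.dim ?B \<le> card ((\<lambda>i. dual_idem rel u0 i *v w) ` ?I)"
      by (intro vec.dim_le_card) auto
    also have "\<dots> \<le> ?s" by (rule card_image_le) simp
    finally show ?thesis .
  qed
  ultimately have KB: "krylov \<tau> w ?s = ?B"
    using dimK by (intro vec.subspace_dim_equal) (auto simp: krylov_def)
  \<comment> \<open>The levels from \<open>?\<rho>\<close> to \<open>?\<rho> + (?s - 1)\<close>
    number exactly \<open>?s\<close>, as \<open>?s \<ge> 1\<close>; dual thinness allows at most one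
    dimension per level.\<close>
  let ?F = "filtration W (?\<rho> + (?s - 1))"
  have "krylov \<tau> w ?s \<subseteq> ?F"
    by (rule krylov_subset_filtration[OF W inv wf]) simp
  moreover have "vec.dim ?F \<le> ?s"
  proof -
    have "vec.dim ?F \<le> (\<Sum>k | k \<le> ?\<rho> + (?s - 1) \<and> k \<le> d. vec.dim ((\<lambda>w. E k *v w) ` W))"
      by (rule dim_filtration_le[OF W E_in])
    also have "\<dots> = (\<Sum>k | ?\<rho> \<le> k \<and> k \<le> ?\<rho> + (?s - 1) \<and> k \<le> d. vec.dim ((\<lambda>w. E k *v w) ` W))"
      by (intro sum.mono_neutral_right ballI below_dual_endpoint(2)) auto
    also have "\<dots> \<le> (\<Sum>k | ?\<rho> \<le> k \<and> k \<le> ?\<rho> + (?s - 1) \<and> k \<le> d. 1)"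
      using thin unfolding dual_thin_def by (intro sum_mono) auto
    also have "\<dots> \<le> card {?\<rho>..?\<rho> + (?s - 1)}"
      by (simp only: card_eq_sum[symmetric]) (intro card_mono, auto)
    also have "\<dots> = ?s" using s by simp
    finally show ?thesis .
  qed
  ultimately have KF: "krylov \<tau> w ?s = ?F"
    using dimK subspace_filtration[OF W] by (intro vec.subspace_dim_equal) (auto simp: krylov_def)
  \<comment> \<open>Stability under the \<open>E i\<close> is clear from the filtration, stability
    under the dual idempotents from the description as \<open>?B\<close>.\<close>
  have "T_invariant T ?F"
    unfolding T_invariant_terwilliger_iff[OF subspace_filtration[OF W]]
  proof (intro allI impI ballI conjI)
    fix i u assume i: "i \<le> d" and u: "u \<in> ?F"
    show "E i *v u \<in> ?F"
      using i u E_in by (auto simp: filtration_def E_mult_vec)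
    have "?B \<subseteq> {u. dual_idem rel u0 i *v u \<in> ?B}"
    proof (rule vec.span_minimal)
      show "(\<lambda>i. dual_idem rel u0 i *v w) ` {..d} \<subseteq> {u. dual_idem rel u0 i *v u \<in> ?B}"
      proof (intro image_subsetI CollectI)
        fix j assume "j \<in> {..d}"
        have "dual_idem rel u0 i *v (dual_idem rel u0 j *v w) = (if i = j then dual_idem rel u0 j *v w else 0)"
          by (auto simp: vec_eq_iff dual_idem_vec_nth)
        with \<open>j \<in> {..d}\<close> show "dual_idem rel u0 i *v (dual_idem rel u0 j *v w) \<in> ?B"
          by (auto intro: vec.span_base vec.span_zero)
      qed
      show "vec.subspace {u. dual_idem rel u0 i *v u \<in> ?B}"
        unfolding vec.subspace_def
        by (auto simp: vec.scale matrix_vector_right_distrib vec.span_zero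
            intro: vec.span_add vec.span_scale)
    qed
    then show "dual_idem rel u0 i *v u \<in> ?F"
      using u KB KF by auto
  qed
  moreover have "?F \<subseteq> W" by (auto simp: filtration_def)
  moreover have "?F \<noteq> {0}"
    using w0 wf filtration_mono[of ?\<rho> "?\<rho> + (?s - 1)" W] by auto
  ultimately have "?F = W"
    using min[OF subspace_filtration[OF W]] by blast
  then show thesis
    using that[OF wf _ I] KB KF by simp
qed

text \<open>Put \<open>n = e - \<rho> + 1\<close> with \<open>\<rho>\<close> the dual endpoint. The
  diameter bound says that \<open>w\<close> meets at least \<open>n\<close> shells, so its Krylov
  space of length \<open>n\<close> fills the filtration up to \<open>e\<close>. Restricting it to
  the chosen shells gives the Krylov space of the restricted \<open>w\<close>. Both sides of the
  claim come out as \<open>min p n\<close>.\<close>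

lemma irreducible_restriction_dim:
  assumes irr: "irreducible_module T W" and thin: "dual_thin d E W"
    and e: "e \<le> d" and \<rho>e: "dual_endpoint E W \<le> e"
    and diam: "dual_endpoint E W + module_diameter d (dual_idem rel u0) W \<ge> e"
    and r_inj: "inj_on r {1..p}" and r_le: "\<And>i. i \<in> {1..p} \<Longrightarrow> r i \<le> d" and p: "1 \<le> p"
    and meets: "card {i \<in> {1..p}. \<exists>w\<in>W. dual_idem rel u0 (r i) *v w \<noteq> 0}
           \<ge> min p (e - dual_endpoint E W + 1)"
  shows "vec.dim ((\<lambda>w. restrict_vec (\<Union>i\<in>{1..p}. shell rel u0 (r i)) (\<Sum>j\<le>e. E j *v w)) ` W)
       = (\<Sum>k\<in>{e + 1 - p..e}. vec.dim ((\<lambda>w. E k *v w) ` W))"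
proof -
  let ?\<rho> = "dual_endpoint E W"
  let ?S = "\<Union>i\<in>{1..p}. shell rel u0 (r i)"
  let ?t = "\<lambda>k. vec.dim ((\<lambda>w. E k *v w) ` W)"
  obtain w where wf: "w \<in> filtration W ?\<rho>"
    and span: "W = vec.span ((\<lambda>i. dual_idem rel u0 i *v w) ` {..d})"
    and I: "rel u0 ` {x. w $ x \<noteq> 0} \<noteq> {}"
    using irreducible_module_structure[OF irr thin] .
  let ?I = "rel u0 ` {x. w $ x \<noteq> 0}"
  have W: "vec.subspace W" and inv: "T_invariant T W"
    using irr unfolding irreducible_module_def by blast+
  \<comment> \<open>\<open>W\<close> is spanned by the shell components of \<open>w\<close>, so
    every vector of \<open>W\<close> vanishes wherever \<open>w\<close> does; the shells met by
    \<open>W\<close> are those met by \<open>w\<close>.\<close>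
  have supp: "w $ x \<noteq> 0" if "u \<in> W" "u $ x \<noteq> 0" for u x
  proof -
    have "W \<subseteq> {u. w $ x = 0 \<longrightarrow> u $ x = 0}"
      by (subst span, rule vec.span_minimal) (auto simp: dual_idem_vec_nth vec.subspace_def)
    with that show ?thesis by blast
  qed
  have wW: "w \<in> W" using wf by (simp add: filtration_def)
  have support: "(\<exists>u\<in>W. dual_idem rel u0 i *v u \<noteq> 0) \<longleftrightarrow> i \<in> ?I" for i
  proof
    assume "\<exists>u\<in>W. dual_idem rel u0 i *v u \<noteq> 0"
    then obtain u x where "u \<in> W" "rel u0 x = i" "u $ x \<noteq> 0"
      by (auto simp: vec_eq_iff dual_idem_vec_nth split: if_splits)
    then show "i \<in> ?I" using supp by blast
  next
    assume "i \<in> ?I"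
    then obtain x where "rel u0 x = i" "w $ x \<noteq> 0" by blast
    then have "dual_idem rel u0 i *v w \<noteq> 0"
      by (auto simp: vec_eq_iff dual_idem_vec_nth)
    with wW show "\<exists>u\<in>W. dual_idem rel u0 i *v u \<noteq> 0" by blast
  qed
  have "{i. i \<le> d \<and> (\<exists>u\<in>W. dual_idem rel u0 i *v u \<noteq> 0)} = ?I"
    unfolding support using rel_le by auto
  then have diam': "module_diameter d (dual_idem rel u0) W = card ?I - 1"
    by (simp add: module_diameter_def)
  \<comment> \<open>The diameter is one less than the number of shells; as that number is positive,
    the truncated subtraction is exact.\<close>
  have "card ?I \<ge> 1" using I by (simp add: Suc_le_eq card_gt_0_iff)
  with diam diam' have big: "e - ?\<rho> + 1 \<le> card ?I" by linarith
  have dimK: "vec.dim (krylov \<tau> w (e - ?\<rho> + 1)) = e - ?\<rho> + 1"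
    using big by (simp add: dim_krylov card_\<tau>_image)
  have t1: "?t k \<le> 1" if "k \<le> d" for k
    using thin that unfolding dual_thin_def by blast
  have dimF: "vec.dim (filtration W e) \<le> (\<Sum>k\<in>{?\<rho>..e}. ?t k)"
  proof -
    have "vec.dim (filtration W e) \<le> (\<Sum>k | k \<le> e \<and> k \<le> d. ?t k)"
      by (rule dim_filtration_le[OF W E_in[OF W inv]])
    also have "\<dots> = (\<Sum>k\<in>{?\<rho>..e}. ?t k)"
      using e by (intro sum.mono_neutral_right ballI below_dual_endpoint(2)) auto
    finally show ?thesis .
  qed
  have KF: "krylov \<tau> w (e - ?\<rho> + 1) \<subseteq> filtration W e"
    using krylov_subset_filtration[OF W inv wf, of "e - ?\<rho> + 1" "e - ?\<rho>"] \<rho>e by simp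
  have "(\<Sum>k\<in>{?\<rho>..e}. ?t k) \<le> (\<Sum>k\<in>{?\<rho>..e}. 1)"
    using e by (intro sum_mono t1) auto
  also have "\<dots> = e - ?\<rho> + 1" using \<rho>e by simp
  finally have sum_le: "(\<Sum>k\<in>{?\<rho>..e}. ?t k) \<le> e - ?\<rho> + 1" .
  have KF_eq: "krylov \<tau> w (e - ?\<rho> + 1) = filtration W e"
    using dimK dimF sum_le KF subspace_filtration[OF W]
    by (intro vec.subspace_dim_equal) (auto simp: krylov_def)
  \<comment> \<open>The filtration has dimension \<open>e - ?\<rho> + 1\<close> with that many
    levels of dimension at most 1, so no level can be 0.\<close>
  have t_eq: "?t k = 1" if k: "k \<in> {?\<rho>..e}" for k
  proof (rule ccontr)
    assume "?t k \<noteq> 1"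
    moreover have "?t k \<le> 1" using t1 k e by (meson atLeastAtMost_iff order_trans)
    ultimately have less: "?t k < 1" by linarith
    have "(\<Sum>k\<in>{?\<rho>..e}. ?t k) < (\<Sum>k\<in>{?\<rho>..e}. 1)"
    proof (rule sum_strict_mono_ex1)
      show "\<forall>k\<in>{?\<rho>..e}. ?t k \<le> 1" using t1 e by (meson atLeastAtMost_iff order_trans)
      show "\<exists>k\<in>{?\<rho>..e}. ?t k < 1" using k less by blast
    qed simp
    also have "\<dots> = e - ?\<rho> + 1" using \<rho>e by simp
    finally show False
      using dimF KF_eq dimK by simp
  qed
  \<comment> \<open>Levels below the dual endpoint contribute nothing; the remaining ones contribute
    1 each.\<close>
  have "(\<Sum>k\<in>{e + 1 - p..e}. ?t k) = (\<Sum>k\<in>{max ?\<rho> (e + 1 - p)..e}. ?t k)"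
    by (intro sum.mono_neutral_right ballI below_dual_endpoint(2)) auto
  also have "\<dots> = (\<Sum>k\<in>{max ?\<rho> (e + 1 - p)..e}. 1)"
    using t_eq by (intro sum.cong) auto
  also have "\<dots> = min p (e - ?\<rho> + 1)"
    using \<rho>e p by (auto simp: max_def min_def)
  finally have rhs: "(\<Sum>k\<in>{e + 1 - p..e}. ?t k) = min p (e - ?\<rho> + 1)" .

  let ?R = "restrict_vec ?S"
  let ?J = "{i \<in> {1..p}. r i \<in> ?I}"
  have "{x. ?R w $ x \<noteq> 0} = {x. w $ x \<noteq> 0 \<and> (\<exists>i\<in>{1..p}. rel u0 x = r i)}"
    by (auto simp: restrict_vec_def shell_def)
  then have "rel u0 ` {x. ?R w $ x \<noteq> 0} = r ` ?J"
    by (simp only:) (force simp: image_iff)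
  moreover have "card (r ` ?J) = card ?J"
    by (intro card_image inj_on_subset[OF r_inj]) auto
  ultimately have dimR: "vec.dim (krylov \<tau> (?R w) (e - ?\<rho> + 1)) = min (e - ?\<rho> + 1) (card ?J)"
    by (simp add: dim_krylov card_\<tau>_image)
  \<comment> \<open>\<open>card ?J\<close> lies between \<open>min p (e - ?\<rho> + 1)\<close> and
    \<open>p\<close>, so capping it at \<open>e - ?\<rho> + 1\<close> yields exactly the lower
    bound.\<close>
  have "card ?J \<le> card {1..p}" by (intro card_mono) auto
  then have "card ?J \<le> p" by simp
  moreover have "min p (e - ?\<rho> + 1) \<le> card ?J"
    using meets unfolding support .
  ultimately have "min (e - ?\<rho> + 1) (card ?J) = min p (e - ?\<rho> + 1)" by simp
  moreover have "(\<lambda>w. ?R (\<Sum>j\<le>e. E j *v w)) ` W = krylov \<tau> (?R w) (e - ?\<rho> + 1)"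
  proof -
    have "(\<lambda>w. ?R (\<Sum>j\<le>e. E j *v w)) ` W = ?R ` (\<lambda>w. \<Sum>j\<le>e. E j *v w) ` W"
      by (simp add: image_image)
    also have "\<dots> = ?R ` krylov \<tau> w (e - ?\<rho> + 1)"
      using E_sum_image_eq_filtration[OF W E_in[OF W inv] e] KF_eq by simp
    finally show ?thesis by (simp add: restrict_krylov)
  qed
  ultimately show ?thesis
    using dimR rhs by simp
qed

text \<open>Induction on dimension: split off an irreducible \<open>W\<close> and continue with its
  orthogonal complement, both sides being additive. If the dual endpoint of \<open>W\<close> exceeds
  \<open>e\<close>, then \<open>W\<close> contributes 0 to both.\<close>

lemma restriction_dim:
  assumes e: "e \<le> d" and r_inj: "inj_on r {1..p}" and r_le: "\<And>i. i \<in> {1..p} \<Longrightarrow> r i \<le> d"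
    and p: "1 \<le> p"
    and modules: "\<forall>W. irreducible_module T W \<and> dual_endpoint E W \<le> e \<longrightarrow>
         dual_thin d E W \<and>
         dual_endpoint E W + module_diameter d (dual_idem rel u0) W \<ge> e \<and>
         card {i \<in> {1..p}. \<exists>w\<in>W. dual_idem rel u0 (r i) *v w \<noteq> 0}
           \<ge> min p (e - dual_endpoint E W + 1)"
    and U: "vec.subspace U" "T_invariant T U"
  shows "vec.dim ((\<lambda>w. restrict_vec (\<Union>i\<in>{1..p}. shell rel u0 (r i)) (\<Sum>j\<le>e. E j *v w)) ` U)
       = (\<Sum>k\<in>{e + 1 - p..e}. vec.dim ((\<lambda>w. E k *v w) ` U))"
  using U
proof (induction "vec.dim U" arbitrary: U rule: less_induct)
  case less
  let ?S = "\<Union>i\<in>{1..p}. shell rel u0 (r i)"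
  let ?f = "\<lambda>w. restrict_vec ?S (\<Sum>j\<le>e. E j *v w)"
  note lin = linear_restrict_sum[of ?S E "{..e}"]
  show ?case
  proof (cases "U = {0}")
    case True
    have "?f 0 = 0" by (simp add: restrict_vec_def vec_eq_iff)
    then show ?thesis
      by (simp add: True vec.dim_eq_0 del: vec.dim_insert)
  next
    case False
    obtain W where irr: "irreducible_module T W" and WU: "W \<subseteq> U"
      using exists_irreducible_submodule[OF less.prems False] .
    then have W: "vec.subspace W" "T_invariant T W" "W \<noteq> {0}"
      unfolding irreducible_module_def by blast+
    obtain W' where W': "vec.subspace W'" "T_invariant T W'" "W' \<subseteq> U" "W \<inter> W' = {0}"
      and U_eq: "U = {x + y |x y. x \<in> W \<and> y \<in> W'}"
      using invariant_orthogonal_complement[OF hermitian_adjoint_terwilliger[OF rel_commute]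
          less.prems W(1,2) WU] .
    have "W' \<noteq> U"
      using W(3) W'(4) WU vec.subspace_0[OF W(1)] by blast
    then have "vec.dim W' < vec.dim U"
      using W'(1,3) less.prems(1) vec.subspace_dim_equal[of W' U] by force
    note IH = less.hyps[OF this W'(1,2)]
    have f_in: "?f ` V \<subseteq> V" if V: "vec.subspace V" "T_invariant T V" for V
    proof
      fix y assume "y \<in> ?f ` V"
      then obtain v where v: "v \<in> V" "y = ?f v" by blast
      have v': "(\<Sum>j\<le>e. E j *v v) \<in> V" (is "?v \<in> V")
        using e v(1) by (intro vec.subspace_sum[OF V(1)] E_in[OF V]) auto
      \<comment> \<open>Restriction to the shells is a sum of dual idempotents; summing over the set
        of values of \<open>r\<close> counts each shell once.\<close>
      have "restrict_vec ?S u = (\<Sum>i\<in>r ` {1..p}. dual_idem rel u0 i *v u)" for u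
        by (auto simp: vec_eq_iff restrict_vec_def shell_def dual_idem_vec_nth)
      then have "y = (\<Sum>i\<in>r ` {1..p}. dual_idem rel u0 i *v ?v)"
        using v(2) by simp
      also have "\<dots> \<in> V"
      proof (rule vec.subspace_sum[OF V(1)])
        fix i assume "i \<in> r ` {1..p}"
        then have "i \<le> d" using r_le by blast
        then show "dual_idem rel u0 i *v ?v \<in> V" by (rule dual_idem_in[OF V _ v'])
      qed
      finally show "y \<in> V" .
    qed
    have W_dim: "vec.dim (?f ` W) = (\<Sum>k\<in>{e + 1 - p..e}. vec.dim ((\<lambda>w. E k *v w) ` W))"
    proof (cases "dual_endpoint E W \<le> e")
      case True
      with modules irr have "dual_thin d E W"
        "dual_endpoint E W + module_diameter d (dual_idem rel u0) W \<ge> e"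
        "card {i \<in> {1..p}. \<exists>w\<in>W. dual_idem rel u0 (r i) *v w \<noteq> 0}
           \<ge> min p (e - dual_endpoint E W + 1)"
        by blast+
      then show ?thesis
        using irreducible_restriction_dim[OF irr _ e True _ r_inj r_le p] by blast
    next
      case False
      have zero: "E k *v w = 0" if "k \<le> e" "w \<in> W" for k w
        using that False by (intro below_dual_endpoint(1)) auto
      have "?f w = 0" if "w \<in> W" for w
        using that by (simp add: zero restrict_vec_def vec_eq_iff)
      then have "?f ` W \<subseteq> {0}" by blast
      then have "vec.dim (?f ` W) = 0" by (rule vec.dim_eq_0[THEN iffD2])
      also have "0 = (\<Sum>k\<in>{e + 1 - p..e}. vec.dim ((\<lambda>w. E k *v w) ` W))"
        using False by (intro sum.neutral[symmetric] ballI below_dual_endpoint(2)) auto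
      finally show ?thesis .
    qed
    have E_sub: "(\<lambda>w. E k *v w) ` V \<subseteq> V" if "vec.subspace V" "T_invariant T V" "k \<le> d" for V k
      using E_in[OF that] by blast
    have "vec.dim (?f ` U) = vec.dim (?f ` W) + vec.dim (?f ` W')"
      unfolding U_eq
      by (rule dim_linear_image_direct_sum[OF lin W(1) f_in[OF W(1,2)] W'(1) f_in[OF W'(1,2)] W'(4)])
    moreover have "vec.dim ((\<lambda>w. E k *v w) ` U)
        = vec.dim ((\<lambda>w. E k *v w) ` W) + vec.dim ((\<lambda>w. E k *v w) ` W')" if "k \<le> d" for k
      unfolding U_eq
      by (rule dim_linear_image_direct_sum[OF matrix_vector_mul_linear_gen
            W(1) E_sub[OF W(1,2) that] W'(1) E_sub[OF W'(1,2) that] W'(4)])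
    ultimately show ?thesis
      using W_dim IH e by (simp add: sum.distrib)
  qed
qed

end

section \<open>From submodules to the whole space of functions\<close>

theorem theorem2p5:
  fixes d :: nat and rel :: "'a::finite \<Rightarrow> 'a \<Rightarrow> nat" and u0 :: 'a
    and E :: "nat \<Rightarrow> complex^'a^'a"
    and e p :: nat and r :: "nat \<Rightarrow> nat"
  assumes scheme: "sym_assoc_scheme d rel"
    and idem: "primitive_idempotents d rel E"
    and Qpoly: "Q_polynomial d E"
    and p_pos: "1 \<le> p"
    and e_lo: "p - 1 \<le> e" and e_hi: "e \<le> d"
    and r_mono: "\<forall>i. 1 \<le> i \<and> i < p \<longrightarrow> r i < r (i + 1)"
    and r_bound: "r p \<le> d"
    and modules: "\<forall>W. irreducible_module (terwilliger d rel u0) W \<and> dual_endpoint E W \<le> e \<longrightarrow>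
         dual_thin d E W \<and>
         dual_endpoint E W + module_diameter d (dual_idem rel u0) W \<ge> e \<and>
         card {i \<in> {1..p}. \<exists>w\<in>W. dual_idem rel u0 (r i) *v w \<noteq> 0}
           \<ge> min p (e - dual_endpoint E W + 1)"
  shows "vec.dim (\<Union>j\<in>{0..e}. Lspace_on (E j) (\<Union>i\<in>{1..p}. shell rel u0 (r i)))
           = (\<Sum>k\<in>{e + 1 - p..e}. rank (E k))"
proof -
  interpret Q_polynomial_scheme d rel E
    by unfold_locales (fact scheme idem Qpoly)+
  obtain \<theta> :: "nat \<Rightarrow> complex" where \<theta>: "inj_on \<theta> {..d}"
    "\<And>u0 i j v. i \<le> d \<Longrightarrow> j \<le> d \<Longrightarrow> j + 1 < i \<Longrightarrow>
      E i *v weighted_power (\<lambda>x. \<theta> (rel u0 x)) 1 (E j *v v) = 0"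
    by (rule dual_eigenvalues) (rule that)
  interpret dual_eigenvalue_scheme d rel E u0 \<theta>
    by unfold_locales (use \<theta> in blast)+
  have r_less: "r i < r j" if "1 \<le> i" "i < j" "j \<le> p" for i j
    using that(2,3)
  proof (induction j)
    case (Suc j)
    then have "r j < r (Suc j)" using r_mono that(1) by simp
    with Suc show ?case by (cases "i = j") auto
  qed simp
  have r_inj: "inj_on r {1..p}"
    by (rule linorder_inj_onI') (use r_less in fastforce)
  have r_le: "r i \<le> d" if "i \<in> {1..p}" for i
    using that r_less[of i p] r_bound by (cases "i = p") auto
  let ?S = "\<Union>i\<in>{1..p}. shell rel u0 (r i)"
  let ?f = "\<lambda>w. restrict_vec ?S (\<Sum>j\<le>e. E j *v w)"
  let ?L = "\<Union>j\<in>{0..e}. Lspace_on (E j) ?S"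
  \<comment> \<open>The dimension of the union \<open>?L\<close> is that of its span, the sum of the
    spaces of restricted functions. It is the image of the whole space under \<open>?f\<close>, so
    \<open>restriction_dim\<close> applies with \<open>U = UNIV\<close>.\<close>
  have "range ?f = vec.span ?L"
  proof
    show "range ?f \<subseteq> vec.span ?L"
    proof clarify
      fix w
      have "?f w = (\<Sum>j\<le>e. restrict_vec ?S (E j *v w))"
        by (rule vec.linear_sum[OF linear_restrict_vec])
      also have "\<dots> \<in> vec.span ?L"
      proof (intro vec.span_sum vec.span_base)
        fix j assume "j \<in> {..e}"
        then show "restrict_vec ?S (E j *v w) \<in> ?L"
          unfolding Lspace_on_def Lspace_def by (intro UN_I[of j] imageI rangeI) auto
      qed
      finally show "?f w \<in> vec.span ?L" .
    qed
    have "?L \<subseteq> range ?f"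
    proof
      fix u assume "u \<in> ?L"
      then obtain j v where "j \<in> {0..e}" and u: "u = restrict_vec ?S (E j *v v)"
        unfolding Lspace_on_def Lspace_def by blast
      then have j: "j \<le> e" by simp
      \<comment> \<open>The partial sum of the idempotents fixes the image of \<open>E j\<close> for
        \<open>j \<le> e\<close>, so \<open>E j *v v\<close> is its own preimage.\<close>
      have "(\<Sum>i\<le>e. E i *v (E j *v v)) = (\<Sum>i\<le>e. if i = j then E j *v v else 0)"
        using j e_hi by (intro sum.cong) (auto simp: E_mult_vec)
      then have "restrict_vec ?S (E j *v v) = ?f (E j *v v)"
        using j by simp
      then show "u \<in> range ?f" unfolding u by blast
    qed
    moreover have "vec.subspace (range ?f)"
      by (rule vec.linear_subspace_image[OF linear_restrict_sum vec.subspace_UNIV])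
    ultimately show "vec.span ?L \<subseteq> range ?f" by (rule vec.span_minimal)
  qed
  then have "vec.dim ?L = vec.dim (range ?f)" by (simp add: vec.dim_span)
  also have "\<dots> = (\<Sum>k\<in>{e + 1 - p..e}. vec.dim (range (\<lambda>w. E k *v w)))"
    by (rule restriction_dim[OF e_hi r_inj r_le p_pos modules])
      (auto simp: T_invariant_def vec.subspace_UNIV)
  also have "\<dots> = (\<Sum>k\<in>{e + 1 - p..e}. rank (E k))"
    using e_hi by (intro sum.cong refl rank_symmetric[symmetric] E_nth_commute) auto
  finally show ?thesis .
qed

end
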